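(* Let $D\subsetneq\mathbb{C}$ be a domain and let $f$ map $D$ conformally onto $D'=f(D)\subset\mathbb{C}$. Then $$\frac14\,k_D(x,y)\le k_{D'}(f(x),f(y))\le 4\,k_D(x,y)$$ for all $x,y\in D$, and the constants are both sharp (that is, $4$ cannot be replaced by a smaller constant, and $\tfrac14$ cannot be replaced by a larger constant, so that the corresponding inequality holds for all such $D$, $f$, $x$, $y$).
   Context: A conformal map is an injective holomorphic function. For a domain $D\subsetneq\mathbb{C}$ the quasihyperbolic metric is $$k_D(x,y)=\inf_{\gamma\in\Gamma}\int_\gamma\frac{1}{d(z)}\,|dz|,\quad x,y\in D,$$ where $\Gamma$ is the family of all rectifiable curves in $D$ joining $x$ and $y$, and $d(z)=d(z,\partial D)$ is the Euclidean distance from $z$ to the boundary of $D$. *)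

theory Defs
  imports "HOL-Analysis.Analysis"
begin

text \<open>Lengths of the polygons inscribed in \<open>g\<close> restricted to \<open>[a, b]\<close>.\<close>

definition polygon_lengths :: "(real \<Rightarrow> 'a::metric_space) \<Rightarrow> real \<Rightarrow> real \<Rightarrow> real set" where
  "polygon_lengths g a b =
     {\<Sum>i<n. dist (g (t i)) (g (t (Suc i))) | (n::nat) t.
        t 0 = a \<and> t n = b \<and> (\<forall>i<n. t i \<le> t (Suc i))}"

definition curve_length :: "(real \<Rightarrow> 'a::metric_space) \<Rightarrow> real \<Rightarrow> real \<Rightarrow> real" where
  "curve_length g a b = Sup (polygon_lengths g a b)"

definition rectifiable_path :: "(real \<Rightarrow> 'a::metric_space) \<Rightarrow> bool" where
  "rectifiable_path g \<longleftrightarrow> path g \<and> bdd_above (polygon_lengths g 0 1)"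

text \<open>The arc length function \<open>t \<mapsto> curve_length g 0 t\<close> of a rectifiable path is nondecreasing and
  continuous on \<open>[0, 1]\<close>. It is extended to the real line by constants, because
  \<^const>\<open>interval_measure\<close> needs a right-continuous nondecreasing function defined everywhere.
  The integral below is then the Lebesgue-Stieltjes integral of \<open>\<rho> \<circ> g\<close> with respect to arc length.\<close>

definition arclength_measure :: "(real \<Rightarrow> 'a::metric_space) \<Rightarrow> real measure" where
  "arclength_measure g = interval_measure (\<lambda>t. curve_length g 0 (max 0 (min 1 t)))"

definition arclength_integral :: "(real \<Rightarrow> 'a::metric_space) \<Rightarrow> ('a \<Rightarrow> real) \<Rightarrow> real" where
  "arclength_integral g \<rho> = (LINT t:{0..1}|arclength_measure g. \<rho> (g t))"

definition quasihyperbolic :: "complex set \<Rightarrow> complex \<Rightarrow> complex \<Rightarrow> real" where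
  "quasihyperbolic D x y =
     (INF g \<in> {g. rectifiable_path g \<and> path_image g \<subseteq> D \<and> pathstart g = x \<and> pathfinish g = y}.
        arclength_integral g (\<lambda>z. 1 / infdist z (frontier D)))"

definition proper_domain :: "complex set \<Rightarrow> bool" where
  "proper_domain D \<longleftrightarrow> open D \<and> connected D \<and> D \<noteq> {} \<and> D \<noteq> UNIV"

definition conformal_map_on :: "(complex \<Rightarrow> complex) \<Rightarrow> complex set \<Rightarrow> bool" where
  "conformal_map_on f D \<longleftrightarrow> f holomorphic_on D \<and> inj_on f D"

end

theory Submission
  imports Defs "HOL-Complex_Analysis.Complex_Analysis"
begin

text \<open>By the Koebe one-quarter theorem, \<open>f\<close> maps the largest disc around \<open>z\<close> in \<open>D\<close>, of radius \<open>d(z)\<close>,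
  onto a set containing the disc of radius \<open>\<bar>f' z\<bar> * d(z) / 4\<close> around \<open>f z\<close>. Hence
  \<open>\<bar>f' z\<bar> / d'(f z) \<le> 4 / d(z)\<close>, and integration along curves gives the upper bound; the lower bound
  is the upper bound for the inverse map. The Koebe function \<open>z / (1 - z)\<^sup>2\<close> on the unit disc, for
  which \<open>d(0) = 1\<close> and \<open>d'(0) = 1 / 4\<close>, shows sharpness when \<open>x = 0\<close> and \<open>y\<close> tends to \<open>0\<close>.

  The one-quarter theorem follows as usual from the bound for the second coefficient of univalent
  functions, which rests on the area theorem for univalent \<open>F z = 1 / z + c * z + \<dots>\<close> on the
  punctured disc. Instead of the area of the omitted set, the proof of the latter computes the area of
  the image of the annulus \<open>r < \<bar>z\<bar> < \<rho>\<close>, which lies inside the image of the circle of radius \<open>r\<close>,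
  and lets \<open>r\<close> tend to \<open>0\<close> and \<open>\<rho>\<close> to \<open>1\<close>.\<close>

unbundle no fps_syntax

section \<open>Areas of conformal images\<close>

text \<open>Curves are only rectifiable, so the density estimate cannot be integrated by
  differentiating them. It is passed on through local Lipschitz bounds: near a parameter t the curve
  \<open>f o g\<close> is at most |f' (g t)| + e times as long as \<open>g\<close>, and bisection of
  the parameter interval adds the local inequalities up, with a total error proportional to the
  length of \<open>g\<close>. The image must also be shown to be a proper domain. Otherwise its
  frontier would be empty, the distance to it 0 by convention, the image metric identically 0 and
  the lower bound false. This is the one-quarter theorem once more, applied to the inverse map on
  discs of arbitrarily large radius. For sharpness, the Koebe function has derivative 1 at 0, so
  there the density changes by exactly the factor 4. The bounds x / (1 - x) for the disc and r /
  (1/4 + r) for its image, with r = koebe x, agree with the two metrics to first order at 0, and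
  their quotient tends to 4. The inverse of the Koebe function gives 1/4.\<close>

lemma continuous_on_vec2 [continuous_intros]:
  fixes f g :: "'a::topological_space \<Rightarrow> real"
  assumes "continuous_on S f" "continuous_on S g"
  shows "continuous_on S (\<lambda>x. vector [f x, g x] :: real^2)"
proof -
  have "(\<lambda>x. vector [f x, g x] :: real^2) = (\<lambda>x. \<chi> i. if i = 1 then f x else g x)"
    by (auto simp: vec_eq_iff forall_2)
  moreover have "continuous_on S (\<lambda>x. (\<chi> i. if i = 1 then f x else g x) :: real^2)"
  proof (rule continuous_on_vec_lambda)
    show "continuous_on S (\<lambda>x. if i = 1 then f x else g x)" for i :: 2
      by (cases "i = 1") (auto simp: assms)
  qed
  ultimately show ?thesis by metis
qed

text \<open>The change of variables formula is used on \<open>real^2\<close>, where determinants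
  live, and Fubini on pairs. Both Lebesgue measures are determined by boxes, and a box corresponds
  to a box with the same sides.\<close>

lemma lborel_vec2:
  "(lborel :: (real^2) measure) = distr lborel borel (\<lambda>(s,t). vector [s,t])"
proof (rule lborel_eqI)
  have meas: "(\<lambda>(s,t). vector [s,t] :: real^2) \<in> borel_measurable (lborel :: (real \<times> real) measure)"
    by simp (intro borel_measurable_continuous_onI, auto simp: case_prod_beta intro!: continuous_intros)
  fix l u :: "real^2"
  assume lu: "\<And>b. b \<in> Basis \<Longrightarrow> l \<bullet> b \<le> u \<bullet> b"
  have le: "l $ 1 \<le> u $ 1" "l $ 2 \<le> u $ 2"
    using lu[of "axis 1 1"] lu[of "axis 2 1"] by (auto simp: cart_eq_inner_axis axis_in_Basis_iff)
  have pre: "(\<lambda>(s,t). vector [s,t]) -` box l u = box (l $ 1, l $ 2) (u $ 1, u $ 2)"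
    by (auto simp: mem_box_cart forall_2 box_prod)
  have B: "(Basis :: (real^2) set) = {axis 1 1, axis 2 1}"
    by (auto simp: Basis_vec_def UNIV_2)
  have ne: "axis 1 (1::real) \<noteq> (axis 2 1 :: real^2)"
    by (simp add: axis_eq_axis)
  show "emeasure (distr lborel borel (\<lambda>(s,t). vector [s,t])) (box l u) = ennreal (\<Prod>b\<in>Basis. (u - l) \<bullet> b)"
    using le
    by (subst emeasure_distr[OF meas])
       (auto simp: pre emeasure_lborel_box_eq Basis_prod_def B ne inner_axis prod.union_disjoint
          prod.insert_if inner_diff_left)
qed simp

text \<open>The area integral arises over a rectangle in \<open>real^2\<close> but is estimated one
  vertical segment, that is one circle, at a time.\<close>

lemma integral_cbox_vec2:
  fixes f :: "real^2 \<Rightarrow> real"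
  assumes "continuous_on (cbox (vector [a,c]) (vector [b,d])) f"
  shows "integral (cbox (vector [a,c]) (vector [b,d])) f
         = integral {a..b} (\<lambda>s. integral {c..d} (\<lambda>t. f (vector [s,t])))"
proof -
  let ?C = "cbox (vector [a,c]) (vector [b,d]) :: (real^2) set"
  have meas: "(\<lambda>(s,t). vector [s,t] :: real^2) \<in> borel_measurable (borel :: (real \<times> real) measure)"
    by (intro borel_measurable_continuous_onI)
       (auto simp: case_prod_beta intro!: continuous_intros)
  have pre: "vector [s,t] \<in> ?C \<longleftrightarrow> (s,t) \<in> cbox (a,c) (b,d)" for s t
    by (auto simp: mem_box_cart forall_2)
  have int: "set_integrable lborel ?C f"
    using assms unfolding set_integrable_def by (intro borel_integrable_compact) auto
  have cont: "continuous_on (cbox (a,c) (b,d)) (\<lambda>(s,t). f (vector [s,t]))"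
    unfolding case_prod_beta
    by (rule continuous_on_compose2[OF assms])
       (auto simp: mem_box_cart forall_2 intro!: continuous_intros)
  have int2: "set_integrable lborel (cbox (a,c) (b,d)) (\<lambda>(s,t). f (vector [s,t]))"
    using cont unfolding set_integrable_def by (intro borel_integrable_compact) auto
  have "integral ?C f = (LINT x:?C|lborel. f x)"
    using set_borel_integral_eq_integral(2)[OF int] by simp
  also have "\<dots> = (LINT x|distr lborel borel (\<lambda>(s,t). vector [s,t]). indicator ?C x *\<^sub>R f x)"
    unfolding set_lebesgue_integral_def using lborel_vec2 by simp
  also have "\<dots> = (LINT p|lborel. indicator ?C (case p of (s,t) \<Rightarrow> vector [s,t]) *\<^sub>R f (case p of (s,t) \<Rightarrow> vector [s,t]))"
    using int meas unfolding set_integrable_def 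
    by (intro integral_distr) auto
  also have "\<dots> = (LINT p:cbox (a,c) (b,d)|lborel. (case p of (s,t) \<Rightarrow> f (vector [s,t])))"
    unfolding set_lebesgue_integral_def
    by (intro Bochner_Integration.integral_cong) (auto simp: pre indicator_def)
  also have "\<dots> = integral (cbox (a,c) (b,d)) (\<lambda>(s,t). f (vector [s,t]))"
    using set_borel_integral_eq_integral(2)[OF int2] by simp
  also have "\<dots> = integral {a..b} (\<lambda>s. integral {c..d} (\<lambda>t. f (vector [s,t])))"
    using integral_prod_continuous[OF cont] by simp
  finally show ?thesis .
qed

definition vec_of_complex :: "complex \<Rightarrow> real^2" where
  "vec_of_complex z = vector [Re z, Im z]"

definition complex_of_vec :: "real^2 \<Rightarrow> complex" where
  "complex_of_vec v = Complex (v $ 1) (v $ 2)"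

lemma complex_of_vec_inverse [simp]:
  "complex_of_vec (vec_of_complex z) = z" "vec_of_complex (complex_of_vec v) = v"
  by (auto simp: complex_of_vec_def vec_of_complex_def complex_eq_iff vec_eq_iff forall_2)

lemma norm_vec_of_complex [simp]: "norm (vec_of_complex z) = cmod z"
  by (simp add: vec_of_complex_def norm_vec_def L2_set_def UNIV_2 cmod_def)

lemma bounded_linear_vec_of_complex: "bounded_linear vec_of_complex"
proof (rule bounded_linear_intro[where K=1])
qed (auto simp: vec_of_complex_def vec_eq_iff forall_2 norm_vec_of_complex[unfolded vec_of_complex_def])

lemma norm_complex_of_vec [simp]: "cmod (complex_of_vec v) = norm v"
  using norm_vec_of_complex[of "complex_of_vec v"] by simp

lemma bounded_linear_complex_of_vec: "bounded_linear complex_of_vec"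
proof (rule bounded_linear_intro[where K=1])
  show "norm (complex_of_vec x) \<le> norm x * 1" for x by simp
qed (auto simp: complex_of_vec_def complex_eq_iff)

text \<open>In Wirtinger derivatives this is the Jacobian |g_z|^2 - |g_zbar|^2, used below for the
  derivative of \<open>H - \<beta> * cnj H\<close>.\<close>

lemma det_conjugate_linear:
  "det (matrix (\<lambda>v. vec_of_complex (a * complex_of_vec v - b * cnj (complex_of_vec v))))
     = (cmod a)\<^sup>2 - (cmod b)\<^sup>2"
  unfolding cmod_power2
  by (simp add: det_2 matrix_def vec_of_complex_def complex_of_vec_def axis_def
      algebra_simps power2_eq_square)

text \<open>The real-linear map \<open>w \<mapsto> w - \<beta> * cnj w\<close> has Jacobian \<open>1 - \<bar>\<beta>\<bar>\<^sup>2\<close>.\<close>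

lemma integral_jacobian_le:
  fixes H :: "complex \<Rightarrow> complex"
  assumes holo: "H holomorphic_on S" and "open S" 
    and sub: "\<And>s t. s \<in> {a..b} \<Longrightarrow> t \<in> {c..d} \<Longrightarrow> Complex s t \<in> S"
    and inj: "inj_on H {z. Re z \<in> {a<..<b} \<and> Im z \<in> {c<..<d}}"
    and beta: "cmod \<beta> < 1"
    and bound: "\<And>z. Re z \<in> {a<..<b} \<Longrightarrow> Im z \<in> {c<..<d} \<Longrightarrow> cmod (H z - \<beta> * cnj (H z)) \<le> M" and "M \<ge> 0"
  shows "(1 - (cmod \<beta>)\<^sup>2) * integral {a..b} (\<lambda>s. integral {c..d} (\<lambda>t. (cmod (deriv H (Complex s t)))\<^sup>2)) \<le> pi * M\<^sup>2"
proof -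
  let ?l = "vector [a,c] :: real^2" and ?u = "vector [b,d] :: real^2"
  \<comment> \<open>The rectangle is open because in the application \<open>H\<close> takes equal
    values on the sides Im z = 0 and Im z = 2 * pi. Integrability comes from continuity on the
    closed rectangle.\<close>
  let ?B = "box ?l ?u"
  define g where "g = (\<lambda>v. vec_of_complex (H (complex_of_vec v) - \<beta> * cnj (H (complex_of_vec v))))"
  define D where "D = (\<lambda>v. deriv H (complex_of_vec v))"
  define g' where "g' = (\<lambda>v h. vec_of_complex (D v * complex_of_vec h - \<beta> * cnj (D v) * cnj (complex_of_vec h)))"
  have inS: "complex_of_vec v \<in> S" if "v \<in> cbox ?l ?u" for v
    using that sub by (auto simp: complex_of_vec_def mem_box_cart forall_2)
  have inB: "Re (complex_of_vec v) \<in> {a<..<b}" "Im (complex_of_vec v) \<in> {c<..<d}" if "v \<in> ?B" for v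
    using that by (auto simp: complex_of_vec_def mem_box_cart forall_2)
  have der: "(g has_derivative g' v) (at v within ?B)" if "v \<in> ?B" for v
  proof -
    have "(H has_derivative (\<lambda>h. D v * h)) (at (complex_of_vec v))"
      using holomorphic_derivI[OF holo \<open>open S\<close> inS] that box_subset_cbox 
      unfolding D_def has_field_derivative_def by blast
    then have 1: "((\<lambda>v. H (complex_of_vec v)) has_derivative (\<lambda>h. D v * complex_of_vec h)) (at v)"
      by (rule has_derivative_compose[OF bounded_linear_imp_has_derivative[OF bounded_linear_complex_of_vec]])
    have 2: "((\<lambda>v. H (complex_of_vec v) - \<beta> * cnj (H (complex_of_vec v))) has_derivative 
        (\<lambda>h. D v * complex_of_vec h - \<beta> * cnj (D v) * cnj (complex_of_vec h))) (at v)"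
      by (rule has_derivative_eq_rhs[OF has_derivative_diff[OF 1
            has_derivative_mult_right[OF bounded_linear.has_derivative[OF bounded_linear_cnj 1]]]])
         (simp add: mult.assoc)
    show ?thesis
      unfolding g_def g'_def
      by (rule has_derivative_at_withinI[OF has_derivative_compose[OF 2 bounded_linear_imp_has_derivative[OF bounded_linear_vec_of_complex]]])
  qed
  have det: "\<bar>det (matrix (g' v))\<bar> = (1 - (cmod \<beta>)\<^sup>2) * (cmod (D v))\<^sup>2" for v
  proof -
    have "(cmod \<beta>)\<^sup>2 < 1" using beta by (simp add: abs_square_less_1)
    moreover have "det (matrix (g' v)) = (1 - (cmod \<beta>)\<^sup>2) * (cmod (D v))\<^sup>2"
      unfolding g'_def det_conjugate_linear by (simp add: norm_mult power_mult_distrib algebra_simps)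
    ultimately show ?thesis by simp
  qed
  \<comment> \<open>\<open>w - \<beta> * cnj w\<close> has trivial kernel because |\<beta>| < 1, so
    injectivity is inherited from \<open>H\<close>.\<close>
  have injg: "inj_on g ?B"
  proof (rule inj_onI)
    fix v w assume v: "v \<in> ?B" and w: "w \<in> ?B" and eq: "g v = g w"
    define \<delta> where "\<delta> = H (complex_of_vec v) - H (complex_of_vec w)"
    have "complex_of_vec (g v) = complex_of_vec (g w)" using eq by simp
    then have "\<delta> = \<beta> * cnj \<delta>"
      by (simp add: g_def \<delta>_def algebra_simps)
    then have "cmod \<delta> = cmod \<beta> * cmod \<delta>" by (metis complex_mod_cnj norm_mult)
    then have "\<delta> = 0" using beta by auto
    then have "complex_of_vec v = complex_of_vec w"
      using inj inB[OF v] inB[OF w] unfolding inj_on_def \<delta>_def by auto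
    then show "v = w" by (metis complex_of_vec_inverse(2))
  qed
  have contD: "continuous_on (cbox ?l ?u) (\<lambda>v. (cmod (D v))\<^sup>2)"
    unfolding D_def
    by (intro continuous_intros continuous_on_compose2[OF holomorphic_on_imp_continuous_on[OF holomorphic_deriv[OF holo \<open>open S\<close>]]]
        linear_continuous_on bounded_linear_complex_of_vec) (use inS in auto)
  have contJ: "continuous_on (cbox ?l ?u) (\<lambda>v. \<bar>det (matrix (g' v))\<bar>)"
    unfolding det by (intro continuous_intros contD)
  have "(\<lambda>v. \<bar>det (matrix (g' v))\<bar>) integrable_on ?B"
    unfolding integrable_on_open_interval using contJ by (rule integrable_continuous)
  then have int: "((\<lambda>v. \<bar>det (matrix (g' v))\<bar>) has_integral integral ?B (\<lambda>v. \<bar>det (matrix (g' v))\<bar>)) ?B"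
    by (rule integrable_integral)
  have img: "g ` ?B \<in> lmeasurable" "measure lebesgue (g ` ?B) = integral ?B (\<lambda>v. \<bar>det (matrix (g' v))\<bar>)"
    using has_measure_differentiable_image[OF _ der injg, THEN iffD2, OF _ _ int] by auto
  have "g ` ?B \<subseteq> cball 0 M"
    using bound inB by (auto simp: g_def)
  then have "measure lebesgue (g ` ?B) \<le> measure lebesgue (cball (0::real^2) M)"
    using img by (intro measure_mono_fmeasurable) auto
  also have "\<dots> = pi * M\<^sup>2"
    using content_cball[OF \<open>M \<ge> 0\<close>, of "0 :: real^2"] by (simp add: unit_ball_vol_2)
  finally have "integral ?B (\<lambda>v. \<bar>det (matrix (g' v))\<bar>) \<le> pi * M\<^sup>2" using img by simp
  also have "integral ?B (\<lambda>v. \<bar>det (matrix (g' v))\<bar>) = (1 - (cmod \<beta>)\<^sup>2) * integral (cbox ?l ?u) (\<lambda>v. (cmod (D v))\<^sup>2)"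
    unfolding det by (simp add: integral_open_interval)
  also have "integral (cbox ?l ?u) (\<lambda>v. (cmod (D v))\<^sup>2) 
      = integral {a..b} (\<lambda>s. integral {c..d} (\<lambda>t. (cmod (deriv H (Complex s t)))\<^sup>2))"
    using integral_cbox_vec2[OF contD] by (simp add: D_def complex_of_vec_def)
  finally show ?thesis .
qed

section \<open>The area theorem\<close>

lemma holomorphic_mean_value:
  fixes m :: "complex \<Rightarrow> complex"
  assumes "m holomorphic_on cball 0 \<rho>" "\<rho> > 0"
  shows "((\<lambda>t. m (of_real \<rho> * cis t)) has_integral 2 * pi * m 0) {0..2*pi}"
proof -
  have "((\<lambda>u. m u / (u - 0)) has_contour_integral 2 * of_real pi * \<i> * m 0) (circlepath 0 \<rho>)"
    using assms by (intro Cauchy_integral_circlepath_simple) auto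
  then have "((\<lambda>t. m (0 + \<rho> * cis t) / (0 + \<rho> * cis t - 0) * \<rho> * \<i> * cis t) has_integral
      2 * of_real pi * \<i> * m 0) {0..2*pi}"
    unfolding circlepath_def by (subst (asm) has_contour_integral_part_circlepath_iff) auto
  then have "((\<lambda>t. m (of_real \<rho> * cis t) * \<i>) has_integral 2 * of_real pi * \<i> * m 0) {0..2*pi}"
    by (rule has_integral_eq[rotated]) (use assms in \<open>simp add: field_simps\<close>)
  from has_integral_mult_left[OF this, of "-\<i>"] show ?thesis
    by (simp add: algebra_simps)
qed

lemma cmod_add_squared: "(cmod (x + y))\<^sup>2 = (cmod x)\<^sup>2 + (cmod y)\<^sup>2 + 2 * Re (cnj x * y)"
  unfolding cmod_power2 by (simp add: power2_eq_square algebra_simps)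

text \<open>The integrand is |z * F' z|^2 for F z = 1 / z + c * z + ... on the circle of radius
  \<rho>. Parseval's identity would sum the squares of all coefficients; here the first two are kept
  and |z^2 * p z|^2 is dropped, once the cross terms are seen to integrate to 0.\<close>

lemma integral_cmod_squared_circle_ge:
  fixes p :: "complex \<Rightarrow> complex"
  assumes p: "p holomorphic_on ball 0 1" and \<rho>: "0 < \<rho>" "\<rho> < 1"
  defines "Z \<equiv> \<lambda>t. of_real \<rho> * cis t"
  shows "2 * pi * (1 / \<rho>\<^sup>2 + (cmod c)\<^sup>2 * \<rho>\<^sup>2)
     \<le> integral {0..2*pi} (\<lambda>t. (cmod (- 1 / Z t + c * Z t + (Z t)\<^sup>2 * p (Z t)))\<^sup>2)"
proof -
  \<comment> \<open>The cross products of the three summands, with \<open>cnj z\<close> replaced by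
    \<open>\<rho>^2 / z\<close>, which is correct on the circle. In this form they are holomorphic
    and vanish at 0, so their mean over the circle is 0.\<close>
  define m where "m = (\<lambda>z. - c * z\<^sup>2 / of_real (\<rho>\<^sup>2) + (- (z^3) / of_real (\<rho>\<^sup>2) + cnj c * of_real (\<rho>\<^sup>2) * z) * p z)"
  define N where "N = 1 / \<rho>\<^sup>2 + (cmod c)\<^sup>2 * \<rho>\<^sup>2"
  have sub: "cball (0::complex) \<rho> \<subseteq> ball 0 1" using \<rho> by auto
  have "m holomorphic_on cball 0 \<rho>"
    unfolding m_def by (intro holomorphic_intros holomorphic_on_subset[OF p sub]) (use \<rho> in auto)
  then have "((\<lambda>t. m (Z t)) has_integral 2 * pi * m 0) {0..2*pi}"
    unfolding Z_def using \<rho> by (intro holomorphic_mean_value) auto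
  then have "((\<lambda>t. Re (m (Z t))) has_integral Re (2 * pi * m 0)) {0..2*pi}"
    by (rule has_integral_Re)
  then have "((\<lambda>t. N + 2 * Re (m (Z t))) has_integral (2 * pi * N + 2 * 0)) {0..2*pi}"
    using has_integral_const_real[of N 0 "2*pi"]
    by (intro has_integral_add has_integral_mult_right) (simp_all add: m_def)
  then have low: "integral {0..2*pi} (\<lambda>t. N + 2 * Re (m (Z t))) = 2 * pi * N"
      "(\<lambda>t. N + 2 * Re (m (Z t))) integrable_on {0..2*pi}"
    by (auto simp: has_integral_iff)
  have Z: "Z t \<noteq> 0" "cmod (Z t) = \<rho>" for t
    using \<rho> by (auto simp: Z_def norm_mult)
  then have Zc: "Z t * cnj (Z t) = of_real (\<rho>\<^sup>2)" for t
    by (metis complex_norm_square)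
  have pt: "N + 2 * Re (m (Z t)) \<le> (cmod (- 1 / Z t + c * Z t + (Z t)\<^sup>2 * p (Z t)))\<^sup>2" for t
  proof -
    define z where "z = Z t"
    have z: "z \<noteq> 0" "cmod z = \<rho>" "z * cnj z = of_real (\<rho>\<^sup>2)" using Z[of t] Zc[of t] by (auto simp: z_def)
    have inv: "cnj (1 / z) = z / of_real (\<rho>\<^sup>2)" 
      using z \<rho> by (simp add: field_simps del: of_real_power)
    have cz: "cnj z = of_real (\<rho>\<^sup>2) / z" using z \<rho> by (simp add: field_simps del: of_real_power)
    let ?a = "- 1 / z + c * z" and ?b = "z\<^sup>2 * p z"
    have ca: "cnj ?a = - z / of_real (\<rho>\<^sup>2) + cnj c * (of_real (\<rho>\<^sup>2) / z)"
      using inv cz by simp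
    have "(cmod ?a)\<^sup>2 = (cmod (- 1 / z))\<^sup>2 + (cmod (c * z))\<^sup>2 + 2 * Re (cnj (- 1 / z) * (c * z))"
      by (rule cmod_add_squared)
    also have "cnj (- 1 / z) * (c * z) = - c * z\<^sup>2 / of_real (\<rho>\<^sup>2)"
      using inv by (simp add: power2_eq_square)
    also have "(cmod (- 1 / z))\<^sup>2 + (cmod (c * z))\<^sup>2 = N"
      using z by (simp add: N_def norm_divide norm_mult power_mult_distrib power_divide)
    finally have a: "(cmod ?a)\<^sup>2 = N + 2 * Re (- c * z\<^sup>2 / of_real (\<rho>\<^sup>2))" .
    have B: "cnj ?a * ?b = (- (z^3) / of_real (\<rho>\<^sup>2) + cnj c * of_real (\<rho>\<^sup>2) * z) * p z"
      unfolding ca using z by (simp add: field_simps power2_eq_square power3_eq_cube)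
    have "Re (m z) = Re (- c * z\<^sup>2 / of_real (\<rho>\<^sup>2)) + Re (cnj ?a * ?b)"
      unfolding m_def B by (rule plus_complex.sel)
    with a cmod_add_squared[of ?a ?b] have "(cmod (?a + ?b))\<^sup>2 = N + 2 * Re (m z) + (cmod ?b)\<^sup>2"
      by linarith
    then show ?thesis unfolding z_def by simp
  qed
  have contp: "continuous_on {0..2*pi} (\<lambda>t. p (Z t))"
    by (rule continuous_on_compose2[OF holomorphic_on_imp_continuous_on[OF p]])
       (use \<rho> in \<open>auto simp: Z_def norm_mult intro!: continuous_intros\<close>)
  have "(\<lambda>t. (cmod (- 1 / Z t + c * Z t + (Z t)\<^sup>2 * p (Z t)))\<^sup>2) integrable_on {0..2*pi}"
    by (rule integrable_continuous_interval)
       (intro continuous_intros contp, use Z \<rho> in \<open>auto simp: Z_def intro!: continuous_intros\<close>)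
  then have "integral {0..2*pi} (\<lambda>t. N + 2 * Re (m (Z t)))
     \<le> integral {0..2*pi} (\<lambda>t. (cmod (- 1 / Z t + c * Z t + (Z t)\<^sup>2 * p (Z t)))\<^sup>2)"
    using pt low by (intro integral_le) auto
  then show ?thesis using low by (simp add: N_def)
qed

text \<open>The connected set \<open>- C\<close> is covered by the image of 0 < |z| < r. That image
  is open, and it is closed relative to \<open>- C\<close>: the circle itself goes into
  \<open>C\<close>, and a sequence tending to 0 has no finite limit of images because of the pole.
  The pole also makes it meet \<open>- C\<close>. By injectivity no room is left there for images of
  points outside the circle.\<close>

lemma image_outside_circle_subset:
  fixes F :: "complex \<Rightarrow> complex"
  assumes holo: "F holomorphic_on ball 0 1 - {0}" and inj: "inj_on F (ball 0 1 - {0})"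
    and pole: "filterlim F at_infinity (at 0)"
    and C: "compact C" "convex C" and r: "0 < r" "r < 1" and circ: "F ` sphere 0 r \<subseteq> C"
    and z: "r < cmod z" "cmod z < 1"
  shows "F z \<in> C"
proof (rule ccontr)
  assume "F z \<notin> C"
  have cont: "continuous_on (ball 0 1 - {0}) F" by (rule holomorphic_on_imp_continuous_on[OF holo])
  let ?A = "F ` (ball 0 r - {0})" and ?B = "F ` (cball 0 r - {0})"
  have "open ?A"
  proof (rule open_mapping_thm3)
    have "ball 0 r - {0} \<subseteq> ball (0::complex) 1 - {0}" using r by auto
    then show "F holomorphic_on ball 0 r - {0}" "inj_on F (ball 0 r - {0})"
      using holo inj by (auto intro: holomorphic_on_subset inj_on_subset)
  qed auto
  have "closed ?B"
    unfolding closed_sequential_limits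
  proof (intro allI impI, elim conjE)
    fix y l assume y: "\<forall>n. y n \<in> ?B" and lim: "y \<longlonglongrightarrow> l"
    have "\<forall>n. \<exists>x. x \<in> cball 0 r - {0} \<and> y n = F x"
    proof
      fix n from y have "y n \<in> ?B" by blast
      then show "\<exists>x. x \<in> cball 0 r - {0} \<and> y n = F x" by blast
    qed
    then obtain x where x: "\<And>n. x n \<in> cball 0 r - {0}" "\<And>n. y n = F (x n)"
      by metis
    have "\<forall>n. x n \<in> cball 0 r" using x by auto
    then obtain w \<phi> where w: "w \<in> cball 0 r" "strict_mono \<phi>" "(x \<circ> \<phi>) \<longlonglongrightarrow> w"
      using compact_cball[of "0::complex" r] unfolding compact_def by metis
    have lim': "(\<lambda>n. F ((x \<circ> \<phi>) n)) \<longlonglongrightarrow> l"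
      using LIMSEQ_subseq_LIMSEQ[OF lim w(2)] x by (simp add: o_def)
    have "w \<noteq> 0"
    proof
      assume "w = 0"
      then have "filterlim (x \<circ> \<phi>) (at 0) sequentially"
        using w x by (auto simp: filterlim_at)
      then have "filterlim (\<lambda>n. F ((x \<circ> \<phi>) n)) at_infinity sequentially"
        by (rule filterlim_compose[OF pole])
      with lim' show False
        using not_tendsto_and_filterlim_at_infinity by (metis sequentially_bot)
    qed
    with w r have "w \<in> ball 0 1 - {0}" by auto
    moreover have "\<forall>\<^sub>F n in sequentially. (x \<circ> \<phi>) n \<in> ball 0 1 - {0}"
    proof (intro always_eventually allI)
      fix n show "(x \<circ> \<phi>) n \<in> ball 0 1 - {0}" using x(1)[of "\<phi> n"] r by auto
    qed
    ultimately have "(\<lambda>n. F ((x \<circ> \<phi>) n)) \<longlonglongrightarrow> F w"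
      using continuous_on_tendsto_compose[OF cont w(3)] by auto
    with lim' have "l = F w" by (rule LIMSEQ_unique)
    with w \<open>w \<noteq> 0\<close> show "l \<in> ?B" by auto
  qed
  have conn: "connected (- C)"
    using C by (intro connected_complement_bounded_convex) (auto simp: compact_imp_bounded)
  have eq: "- C \<inter> ?B = - C \<inter> ?A"
  proof -
    have "F x \<in> ?A" if "x \<in> cball 0 r - {0}" "F x \<notin> C" for x
    proof -
      have "cmod x \<noteq> r" using circ that(2) by (auto simp: image_subset_iff)
      then show ?thesis using that(1) by auto
    qed
    then show ?thesis by auto
  qed
  have "F z \<notin> ?A"
  proof
    assume "F z \<in> ?A"
    then obtain x where x: "F z = F x" "x \<in> ball 0 r - {0}" by (rule imageE)
    have "z \<noteq> 0" using z r by auto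
    then have "z = x" using inj_onD[OF inj x(1)] x(2) z r by auto
    then show False using x z by auto
  qed
  moreover have "- C \<inter> ?A \<noteq> {}"
  proof -
    obtain K where K: "\<And>w. w \<in> C \<Longrightarrow> norm w \<le> K" 
      using compact_imp_bounded[OF C(1)] by (auto simp: bounded_iff)
    have "\<forall>\<^sub>F x in at 0. norm (F x) > K"
      using pole unfolding filterlim_at_infinity_conv_norm_at_top filterlim_at_top_dense by auto
    moreover have "\<forall>\<^sub>F x::complex in at 0. x \<in> ball 0 r - {0}"
      using r eventually_at_in_open[of "ball 0 r" "0::complex"] by auto
    ultimately have "\<forall>\<^sub>F x in at 0. norm (F x) > K \<and> x \<in> ball 0 r - {0}"
      by (rule eventually_conj)
    then obtain x where "norm (F x) > K" "x \<in> ball 0 r - {0}"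
      using eventually_happens'[OF at_neq_bot] by blast
    then show ?thesis using K by force
  qed
  ultimately show False
    using connectedD[OF conn \<open>open ?A\<close> open_Compl[OF \<open>closed ?B\<close>]] eq \<open>F z \<notin> C\<close> by blast
qed

text \<open>The image of the circle of radius \<open>r\<close> is up to \<open>O(r\<^sup>2)\<close> an ellipse with semiaxes
  \<open>1 / r \<plusminus> \<bar>c\<bar> * r\<close>, and \<open>w \<mapsto> w - c * r\<^sup>2 * cnj w\<close> turns this ellipse into a circle of radius
  at most \<open>1 / r\<close>. A bound by the disc of radius \<open>1 / r + \<bar>c\<bar> * r\<close> around the ellipse would only yield
  \<open>\<bar>c\<bar> \<le> 1 + sqrt 2\<close>.\<close>

theorem area_theorem:
  fixes q :: "complex \<Rightarrow> complex"
  assumes q: "q holomorphic_on ball 0 1"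
    and inj: "inj_on (\<lambda>z. 1 / z + c * z + z\<^sup>2 * q z) (ball 0 1 - {0})"
  shows "cmod c \<le> 1"
proof -
  define F where "F = (\<lambda>z. 1 / z + c * z + z\<^sup>2 * q z)"
  define p where "p = (\<lambda>z. 2 * q z + z * deriv q z)"
  have p: "p holomorphic_on ball 0 1"
    unfolding p_def by (intro holomorphic_intros q) auto
  have holoF: "F holomorphic_on ball 0 1 - {0}"
    unfolding F_def by (intro holomorphic_intros holomorphic_on_subset[OF q]) auto
  have pole: "filterlim F at_infinity (at 0)"
  proof -
    have "isCont q 0" using q by (intro holomorphic_on_imp_continuous_on[THEN continuous_on_interior]) auto
    then have "((\<lambda>z. c * z + z\<^sup>2 * q z) \<longlongrightarrow> c * 0 + 0\<^sup>2 * q 0) (at 0)"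
      unfolding isCont_def by (intro tendsto_intros)
    moreover have "filterlim (\<lambda>z. 1 / z :: complex) at_infinity (at 0)"
      by (rule filterlim_cong[THEN iffD1, OF refl refl _ filterlim_inverse_at_infinity])
         (simp add: inverse_eq_divide)
    ultimately show ?thesis
      unfolding F_def add.assoc using tendsto_add_filterlim_at_infinity' by blast
  qed
  have derF: "(F has_field_derivative (- 1 / z\<^sup>2 + c + z * p z)) (at z)" if "z \<in> ball 0 1 - {0}" for z
  proof -
    have "(q has_field_derivative deriv q z) (at z)"
      using q that by (intro holomorphic_derivI[of q "ball 0 1"]) auto
    then show ?thesis
      unfolding F_def p_def using that
      by (auto intro!: derivative_eq_intros simp: field_simps power2_eq_square)
  qed
  \<comment> \<open>\<open>q\<close> may be unbounded near the unit circle. A bound near 0 suffices,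
    because the inner radius \<open>r\<close> is going to shrink to 0.\<close>
  have "bounded (q ` cball 0 (1/2))"
    using q by (intro compact_imp_bounded compact_continuous_image holomorphic_on_imp_continuous_on
        holomorphic_on_subset[OF q]) auto
  then obtain Q where Q: "Q > 0" "\<And>z. z \<in> cball 0 (1/2) \<Longrightarrow> cmod (q z) \<le> Q"
    unfolding bounded_pos by auto
  \<comment> \<open>The remainder z^2 * q z enters \<open>L (F z)\<close> once directly and once
    conjugated with the factor \<beta>, where |\<beta>| < 1; each contributes at most Q *
    r^2.\<close>
  define K where "K = 2 * Q"
  define X where "X = (cmod c)\<^sup>2"
  \<comment> \<open>Up to the common factor pi, the left side is the Jacobian of the linear map
    times a lower bound for the area of the image of the annulus, and the right side is the area of
    the disc that contains the result.\<close>
  have main: "(1 - X * r^4) * ((1 / r\<^sup>2 - 1 / \<rho>\<^sup>2) + X * (\<rho>\<^sup>2 - r\<^sup>2)) \<le> (1 / r + K * r\<^sup>2)\<^sup>2"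
    if r: "0 < r" "r < 1/2" "cmod c * r\<^sup>2 < 1" and \<rho>: "r < \<rho>" "\<rho> < 1" for r \<rho>
  proof -
    \<comment> \<open>On the circle \<open>cnj (1 / z)\<close> equals z / r^2, so this value makes c
      * z cancel against \<open>\<beta> * cnj (1 / z)\<close>.\<close>
    define \<beta> where "\<beta> = c * of_real (r\<^sup>2)"
    define M where "M = 1 / r + K * r\<^sup>2"
    define L where "L = (\<lambda>w. w - \<beta> * cnj w)"
    define C where "C = {w. cmod (L w) \<le> M}"
    have beta: "cmod \<beta> < 1" using r by (simp add: \<beta>_def norm_mult norm_power)
    have M0: "M \<ge> 0" using r Q by (simp add: M_def K_def)
    have "closed C" unfolding C_def L_def by (intro closed_Collect_le continuous_intros)
    have "convex C"
    proof -
      have "linear L" unfolding L_def by (intro linearI) (auto simp: algebra_simps scaleR_conv_of_real)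
      then have "convex (L -` cball 0 M)" by (intro convex_linear_vimage convex_cball)
      moreover have "L -` cball 0 M = C" by (auto simp: C_def)
      ultimately show ?thesis by simp
    qed
    have "bounded C"
      unfolding bounded_iff
    proof (intro exI ballI)
      fix w assume "w \<in> C"
      have "cmod w - cmod (\<beta> * cnj w) \<le> cmod (L w)" unfolding L_def by (rule norm_triangle_ineq2)
      then have "(1 - cmod \<beta>) * cmod w \<le> M"
        using \<open>w \<in> C\<close> by (simp add: C_def norm_mult algebra_simps)
      then show "norm w \<le> M / (1 - cmod \<beta>)" using beta by (simp add: field_simps)
    qed
    have circ: "F ` sphere 0 r \<subseteq> C"
    proof clarify
      fix z :: complex assume "z \<in> sphere 0 r"
      then have z: "cmod z = r" "z \<noteq> 0" using r by auto
      have zz: "z * cnj z = of_real (r\<^sup>2)" using z by (simp add: complex_norm_square[symmetric] del: of_real_power)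
      have inv: "cnj (1 / z) = z / of_real (r\<^sup>2)" and cz: "cnj z = of_real (r\<^sup>2) / z"
        using zz z r by (simp_all add: field_simps del: of_real_power)
      have "L (F z) = 1 / z - \<beta> * cnj c * cnj z + (z\<^sup>2 * q z - \<beta> * cnj (z\<^sup>2 * q z)) + (c * z - \<beta> * cnj (1 / z))"
        unfolding L_def F_def by (simp add: algebra_simps)
      also have "c * z - \<beta> * cnj (1 / z) = 0"
        unfolding inv \<beta>_def using r by simp
      also have "1 / z - \<beta> * cnj c * cnj z = (1 / z) * of_real (1 - X * r^4)"
      proof -
        have "\<beta> * cnj c * cnj z = (c * cnj c) * of_real (r^4) / z"
          unfolding \<beta>_def cz by (simp add: power4_eq_xxxx power2_eq_square)
        also have "c * cnj c = of_real X" unfolding X_def by (rule complex_norm_square[symmetric])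
        finally show ?thesis by (simp add: field_simps diff_divide_distrib)
      qed
      finally have LF: "L (F z) = (1 / z) * of_real (1 - X * r^4) + (z\<^sup>2 * q z - \<beta> * cnj (z\<^sup>2 * q z))"
        by simp
      have "X * r^4 = (cmod c * r\<^sup>2)\<^sup>2" by (simp add: X_def power_mult_distrib)
      then have X1: "0 \<le> X * r^4" "X * r^4 \<le> 1" using r by (auto simp: power_le_one)
      have "cmod (q z) \<le> Q" using z r by (intro Q) auto
      then have zq: "cmod (z\<^sup>2 * q z) \<le> Q * r\<^sup>2" using z r by (simp add: norm_mult norm_power mult.commute mult_left_mono)
      have "cmod (L (F z)) \<le> cmod ((1 / z) * of_real (1 - X * r^4)) + cmod (z\<^sup>2 * q z - \<beta> * cnj (z\<^sup>2 * q z))"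
        unfolding LF by (rule norm_triangle_ineq)
      also have "\<dots> \<le> cmod ((1 / z) * of_real (1 - X * r^4)) + (cmod (z\<^sup>2 * q z) + cmod (\<beta> * cnj (z\<^sup>2 * q z)))"
        by (intro add_left_mono norm_triangle_ineq4)
      also have "cmod ((1 / z) * of_real (1 - X * r^4)) = (1 / r) * (1 - X * r^4)"
        unfolding norm_mult norm_of_real using z X1 by (simp add: norm_divide)
      also have "\<dots> \<le> 1 / r" using X1 r mult_left_mono[of "1 - X * r^4" 1 "1 / r"] by simp
      also have "cmod (\<beta> * cnj (z\<^sup>2 * q z)) \<le> 1 * cmod (z\<^sup>2 * q z)"
        unfolding norm_mult[of \<beta>] complex_mod_cnj using beta by (intro mult_right_mono) auto
      finally show "F z \<in> C" using zq by (simp add: C_def M_def K_def algebra_simps)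
    qed
    have inC: "F z \<in> C" if "r < cmod z" "cmod z < 1" for z
      using inj \<open>closed C\<close> \<open>bounded C\<close> \<open>convex C\<close> circ that r
      by (intro image_outside_circle_subset[OF holoF _ pole, of C r]) (auto simp: compact_eq_bounded_closed F_def)
    \<comment> \<open>Logarithmic coordinates turn the annulus, slit along the positive real axis,
      into a rectangle, and the factor z in H' = z * F' z accounts for the polar area
      element.\<close>
    define H where "H = (\<lambda>\<zeta>. F (exp \<zeta>))"
    let ?S = "{\<zeta>. Re \<zeta> < 0}"
    have S: "open ?S" by (rule open_halfspace_Re_lt)
    have derH: "(H has_field_derivative (- 1 / exp \<zeta> + c * exp \<zeta> + (exp \<zeta>)\<^sup>2 * p (exp \<zeta>))) (at \<zeta>)"
      if "\<zeta> \<in> ?S" for \<zeta>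
    proof -
      have "exp \<zeta> \<in> ball 0 1 - {0}" using that by simp
      from DERIV_chain2[OF derF[OF this] DERIV_exp] show ?thesis
        unfolding H_def by (rule DERIV_cong) (simp add: field_simps power2_eq_square)
    qed
    then have holoH: "H holomorphic_on ?S"
      using S by (auto simp: holomorphic_on_open)
    define a b where "a = ln r" and "b = ln \<rho>"
    have ab: "a < b" "b < 0" using r \<rho> by (auto simp: a_def b_def)
    have injH: "inj_on H {z. Re z \<in> {a<..<b} \<and> Im z \<in> {0<..<2*pi}}"
    proof (rule inj_onI; clarify)
      fix z w assume z: "Re z \<in> {a<..<b}" "Im z \<in> {0<..<2*pi}" and w: "Re w \<in> {a<..<b}" "Im w \<in> {0<..<2*pi}"
        and "H z = H w"
      then have "exp z = exp w"
        using inj ab unfolding H_def F_def[symmetric] by (auto dest!: inj_onD)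
      moreover have "\<bar>Im z - Im w\<bar> < 2 * pi" using z w by (simp add: abs_less_iff)
      ultimately show "z = w" by (metis exp_complex_eqI)
    qed
    have bound: "cmod (H z - \<beta> * cnj (H z)) \<le> M" if "Re z \<in> {a<..<b}" for z
    proof -
      have "r < exp (Re z)" "exp (Re z) < 1"
        using that ab r exp_less_mono[of a "Re z"] by (auto simp: a_def)
      then have "F (exp z) \<in> C" by (intro inC) auto
      then show ?thesis by (simp add: C_def L_def H_def)
    qed
    let ?I = "\<lambda>s. integral {0..2*pi} (\<lambda>t. (cmod (deriv H (Complex s t)))\<^sup>2)"
    have area: "(1 - (cmod \<beta>)\<^sup>2) * integral {a..b} ?I \<le> pi * M\<^sup>2"
      using ab by (intro integral_jacobian_le[OF holoH S _ injH beta bound M0]) auto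
    have inner: "2 * pi * (exp (- 2 * s) + X * exp (2 * s)) \<le> ?I s" if "s \<in> {a..b}" for s
    proof -
      have "deriv H (Complex s t) = - 1 / (of_real (exp s) * cis t) + c * (of_real (exp s) * cis t)
        + (of_real (exp s) * cis t)\<^sup>2 * p (of_real (exp s) * cis t)" for t
        using DERIV_imp_deriv[OF derH[of "Complex s t"]] that ab by (simp add: exp_eq_polar)
      then show ?thesis
        using integral_cmod_squared_circle_ge[OF p, of "exp s" c] that ab
        by (simp add: X_def exp_minus exp_double[symmetric] inverse_eq_divide)
    qed
    have G: "((\<lambda>s. pi * (- exp (- 2 * s) + X * exp (2 * s))) has_vector_derivative
         2 * pi * (exp (- 2 * s) + X * exp (2 * s))) (at s within {a..b})" for s
      unfolding has_real_derivative_iff_has_vector_derivative[symmetric]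
      by (auto intro!: derivative_eq_intros simp: algebra_simps)
    have ints: "((\<lambda>s. 2 * pi * (exp (- 2 * s) + X * exp (2 * s))) has_integral
       (pi * (- exp (- 2 * b) + X * exp (2 * b)) - pi * (- exp (- 2 * a) + X * exp (2 * a)))) {a..b}"
      using ab by (intro fundamental_theorem_of_calculus[OF _ G]) auto
    have contI: "continuous_on {a..b} ?I"
    proof -
      have "continuous_on ({a..b} \<times> cbox 0 (2*pi)) (\<lambda>x. deriv H (Complex (fst x) (snd x)))"
        by (rule continuous_on_compose2[OF holomorphic_on_imp_continuous_on[OF holomorphic_deriv[OF holoH S]]])
           (use ab in \<open>auto intro!: continuous_intros\<close>)
      then have "continuous_on {a..b} (\<lambda>s. integral (cbox 0 (2*pi)) (\<lambda>t. (cmod (deriv H (Complex s t)))\<^sup>2))"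
        by (intro integral_continuous_on_param) (auto simp: case_prod_beta intro!: continuous_intros)
      then show ?thesis by simp
    qed
    have ea: "exp (- 2 * a) = 1 / r\<^sup>2" "exp (2 * a) = r\<^sup>2"
      and eb: "exp (- 2 * b) = 1 / \<rho>\<^sup>2" "exp (2 * b) = \<rho>\<^sup>2"
      using r \<rho> by (auto simp: a_def b_def exp_minus exp_double inverse_eq_divide)
    have "pi * ((1 / r\<^sup>2 - 1 / \<rho>\<^sup>2) + X * (\<rho>\<^sup>2 - r\<^sup>2))
        = pi * (- exp (- 2 * b) + X * exp (2 * b)) - pi * (- exp (- 2 * a) + X * exp (2 * a))"
      unfolding ea eb by (simp add: algebra_simps)
    also have "\<dots> = integral {a..b} (\<lambda>s. 2 * pi * (exp (- 2 * s) + X * exp (2 * s)))"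
      by (rule integral_unique[OF ints, symmetric])
    also have "\<dots> \<le> integral {a..b} ?I"
      by (rule integral_le[OF has_integral_integrable[OF ints] integrable_continuous_interval[OF contI] inner])
    finally have "pi * ((1 / r\<^sup>2 - 1 / \<rho>\<^sup>2) + X * (\<rho>\<^sup>2 - r\<^sup>2)) \<le> integral {a..b} ?I" .
    moreover have "(cmod \<beta>)\<^sup>2 = X * r^4" by (simp add: \<beta>_def X_def norm_mult norm_power power_mult_distrib)
    moreover have "(cmod \<beta>)\<^sup>2 \<le> 1" using beta by (simp add: power_le_one)
    ultimately have "(1 - X * r^4) * (pi * ((1 / r\<^sup>2 - 1 / \<rho>\<^sup>2) + X * (\<rho>\<^sup>2 - r\<^sup>2))) \<le> (1 - X * r^4) * integral {a..b} ?I"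
      by (intro mult_left_mono) auto
    also have "\<dots> \<le> pi * M\<^sup>2" using area \<open>(cmod \<beta>)\<^sup>2 = X * r^4\<close> by simp
    finally have "pi * ((1 - X * r^4) * ((1 / r\<^sup>2 - 1 / \<rho>\<^sup>2) + X * (\<rho>\<^sup>2 - r\<^sup>2))) \<le> pi * M\<^sup>2"
      by (simp only: mult.left_commute)
    then show ?thesis unfolding M_def by simp
  qed
  have lim1: "X * \<rho>\<^sup>2 - 1 / \<rho>\<^sup>2 \<le> 0" if \<rho>: "0 < \<rho>" "\<rho> < 1" for \<rho>
  proof -
    define A where "A = X * \<rho>\<^sup>2 - 1 / \<rho>\<^sup>2"
    \<comment> \<open>What remains of \<open>main\<close> after 1 / r^2 cancels on both sides. The
      error K * r^2 in the radius is harmless, because even its product with 1 / r tends to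
      0.\<close>
    let ?R = "\<lambda>r::real. 2 * K * r + K\<^sup>2 * r^4 + 2 * X * r\<^sup>2 + X * r^4 * A - X\<^sup>2 * r^6"
    have "\<forall>\<^sub>F r in at_right (0::real). r < 1/2" "\<forall>\<^sub>F r in at_right (0::real). r < \<rho>"
      using \<rho> by (auto intro: eventually_at_right_less simp: eventually_at_right_field intro: exI[of _ "1/2"])
    moreover have "\<forall>\<^sub>F r in at_right (0::real). cmod c * r\<^sup>2 < 1"
    proof -
      have "((\<lambda>r. cmod c * r\<^sup>2) \<longlongrightarrow> cmod c * 0\<^sup>2) (at_right 0)" by (intro tendsto_intros)
      then show ?thesis by (rule order_tendstoD) simp
    qed
    moreover have "\<forall>\<^sub>F r in at_right (0::real). 0 < r" by (simp add: eventually_at_right_less)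
    ultimately have ev: "\<forall>\<^sub>F r in at_right 0. A \<le> ?R r"
    proof eventually_elim
      case (elim r)
      have "(1 - X * r^4) * ((1 / r\<^sup>2 - 1 / \<rho>\<^sup>2) + X * (\<rho>\<^sup>2 - r\<^sup>2)) = 1 / r\<^sup>2 + A - 2 * X * r\<^sup>2 - X * r^4 * A + X\<^sup>2 * r^6"
        using elim by (simp add: A_def field_simps power_numeral_reduce)
      moreover have "(1 / r + K * r\<^sup>2)\<^sup>2 = 1 / r\<^sup>2 + 2 * K * r + K\<^sup>2 * r^4"
        using elim by (simp add: field_simps power_numeral_reduce)
      ultimately show ?case using main[of r \<rho>] elim \<rho> by linarith
    qed
    have "(?R \<longlongrightarrow> 2 * K * 0 + K\<^sup>2 * 0^4 + 2 * X * 0\<^sup>2 + X * 0^4 * A - X\<^sup>2 * 0^6) (at_right 0)"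
      by (intro tendsto_intros)
    then have "A \<le> 2 * K * 0 + K\<^sup>2 * 0^4 + 2 * X * 0\<^sup>2 + X * 0^4 * A - X\<^sup>2 * 0^6"
      by (rule tendsto_le[OF _ _ tendsto_const ev, rotated]) simp
    then show ?thesis by (simp add: A_def)
  qed
  have "\<forall>\<^sub>F \<rho> in at_left (1::real). 0 < \<rho>" "\<forall>\<^sub>F \<rho> in at_left (1::real). \<rho> < 1"
    by (auto simp: eventually_at_left_field intro: exI[of _ 0])
  then have "\<forall>\<^sub>F \<rho> in at_left (1::real). X * \<rho>\<^sup>2 - 1 / \<rho>\<^sup>2 \<le> 0"
    by eventually_elim (use lim1 in auto)
  moreover have "((\<lambda>\<rho>. X * \<rho>\<^sup>2 - 1 / \<rho>\<^sup>2) \<longlongrightarrow> X * 1\<^sup>2 - 1 / 1\<^sup>2) (at_left (1::real))"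
    by (intro tendsto_intros) auto
  ultimately have "X * 1\<^sup>2 - 1 / 1\<^sup>2 \<le> 0"
    by (intro tendsto_upperbound) auto
  then show ?thesis unfolding X_def by (simp add: abs_square_le_1)
qed

section \<open>The Koebe one-quarter theorem\<close>

text \<open>Applied repeatedly, this peels off Taylor coefficients one by one and keeps the
  remainder holomorphic on all of \<open>S\<close>, which is the form of expansion that
  \<open>area_theorem\<close> expects.\<close>

lemma holomorphic_split_off_linear:
  fixes f :: "complex \<Rightarrow> complex"
  assumes "f holomorphic_on S" "open S"
  obtains k where "k holomorphic_on S" "\<And>z. f z = f 0 + z * k z" "k 0 = deriv f 0"
proof
  show "(\<lambda>z. if z = 0 then deriv f 0 else (f z - f 0) / (z - 0)) holomorphic_on S"
    by (rule pole_lemma_open[OF assms])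
qed auto

text \<open>For univalent \<open>f z = z * \<phi> z\<close> the odd transform \<open>sqrt (f (z\<^sup>2))\<close> is univalent as well, and the
  area theorem applies to its reciprocal \<open>1 / z - (\<phi>' 0 / 2) * z + \<dots>\<close>.\<close>

lemma bieberbach_second_coefficient:
  fixes \<phi> :: "complex \<Rightarrow> complex"
  assumes \<phi>: "\<phi> holomorphic_on ball 0 1" and \<phi>0: "\<phi> 0 = 1"
    and inj: "inj_on (\<lambda>z. z * \<phi> z) (ball 0 1)"
  shows "cmod (deriv \<phi> 0) \<le> 2"
proof -
  have nz: "\<phi> z \<noteq> 0" if "z \<in> ball 0 1" for z
  proof
    assume "\<phi> z = 0"
    with that \<phi>0 have "z = 0" using inj_onD[OF inj, of z 0] by auto
    with \<open>\<phi> z = 0\<close> \<phi>0 show False by simp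
  qed
  obtain \<psi> where \<psi>: "\<psi> holomorphic_on ball 0 1" "\<And>z. z \<in> ball 0 1 \<Longrightarrow> \<phi> z = \<psi> z ^ 2"
    using contractible_imp_holomorphic_sqrt[OF \<phi> convex_imp_contractible[OF convex_ball] nz] by metis
  have \<psi>_nz: "\<psi> z \<noteq> 0" if "z \<in> ball 0 1" for z
    using nz[OF that] \<psi>(2)[OF that] by auto
  \<comment> \<open>The reciprocal of a square root of \<open>\<phi>\<close>; as
    \<open>\<psi> 0\<close> is 1 or -1, the numerator normalises it to \<open>h 0 = 1\<close>. Thus
    h (z^2) / z is the reciprocal of the odd transform.\<close>
  define h where "h = (\<lambda>z. \<psi> 0 / \<psi> z)"
  have h: "h holomorphic_on ball 0 1"
    unfolding h_def using \<psi>_nz by (intro holomorphic_intros \<psi>) auto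
  have h0: "h 0 = 1" using \<psi>_nz[of 0] by (simp add: h_def)
  have \<phi>h: "\<phi> z * (h z)\<^sup>2 = 1" if "z \<in> ball 0 1" for z
    using \<psi>(2)[OF that] \<psi>(2)[of 0] \<phi>0 \<psi>_nz[OF that] by (simp add: h_def power_divide)
  obtain k where k: "k holomorphic_on ball 0 1" "\<And>z. h z = h 0 + z * k z" "k 0 = deriv h 0"
    using holomorphic_split_off_linear[OF h open_ball] by metis
  obtain e where e: "e holomorphic_on ball 0 1" "\<And>z. k z = k 0 + z * e z"
    using holomorphic_split_off_linear[OF k(1) open_ball] by metis
  have sq: "z\<^sup>2 \<in> ball 0 1" if "z \<in> ball 0 1" for z :: complex
    using that by (simp add: norm_power power_less_one_iff)
  \<comment> \<open>With h w = 1 + k 0 * w + w^2 * e w, the odd function h (z^2) / z has no constant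
    term, and its remainder z^3 * e (z^2) is z^2 times this function.\<close>
  have q: "(\<lambda>z. z * e (z\<^sup>2)) holomorphic_on ball 0 1"
    using sq by (intro holomorphic_intros holomorphic_on_compose_gen[OF _ e(1), unfolded o_def]) auto
  have F: "1 / z + k 0 * z + z\<^sup>2 * (z * e (z\<^sup>2)) = h (z\<^sup>2) / z" if "z \<noteq> 0" for z
    using that k(2)[of "z\<^sup>2"] e(2)[of "z\<^sup>2"] h0 by (simp add: field_simps power2_eq_square)
  have "inj_on (\<lambda>z. 1 / z + k 0 * z + z\<^sup>2 * (z * e (z\<^sup>2))) (ball 0 1 - {0})"
  proof (rule inj_onI)
    fix z w assume z: "z \<in> ball 0 1 - {0}" and w: "w \<in> ball 0 1 - {0}"
      and "1 / z + k 0 * z + z\<^sup>2 * (z * e (z\<^sup>2)) = 1 / w + k 0 * w + w\<^sup>2 * (w * e (w\<^sup>2))"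
    then have eq: "h (z\<^sup>2) / z = h (w\<^sup>2) / w" using F by auto
    have nz: "h (z\<^sup>2) \<noteq> 0" "h (w\<^sup>2) \<noteq> 0" using \<phi>h[OF sq] z w by force+
    have val: "x\<^sup>2 * \<phi> (x\<^sup>2) = 1 / (h (x\<^sup>2) / x)\<^sup>2" if "x \<in> ball 0 1 - {0}" for x
    proof -
      have "h (x\<^sup>2) \<noteq> 0" using \<phi>h[OF sq, of x] that by force
      then have "\<phi> (x\<^sup>2) = 1 / (h (x\<^sup>2))\<^sup>2" using \<phi>h[OF sq, of x] that by (simp add: field_simps)
      then show ?thesis by (simp add: power_divide)
    qed
    have "z\<^sup>2 * \<phi> (z\<^sup>2) = w\<^sup>2 * \<phi> (w\<^sup>2)" using val[OF z] val[OF w] eq by simp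
    then have "z\<^sup>2 = w\<^sup>2" using inj_onD[OF inj, of "z\<^sup>2" "w\<^sup>2"] sq z w by auto
    \<comment> \<open>So far z = w or z = - w. The numerators in \<open>eq\<close> now coincide and
      are nonzero, which excludes the minus sign.\<close>
    with eq nz show "z = w" using z w by (auto simp: field_simps)
  qed
  then have "cmod (k 0) \<le> 1" by (rule area_theorem[OF q])
  have d\<phi>: "(\<phi> has_field_derivative deriv \<phi> 0) (at 0)" and dh: "(h has_field_derivative deriv h 0) (at 0)"
    using \<phi> h by (auto intro: holomorphic_derivI)
  \<comment> \<open>Differentiating the constant \<phi> * h^2 at 0 relates the coefficient
    \<open>k 0\<close>, bounded by the area theorem, to the second coefficient.\<close>
  have "((\<lambda>z. \<phi> z * (h z)\<^sup>2) has_field_derivative deriv \<phi> 0 + 2 * deriv h 0) (at 0)"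
    by (rule derivative_eq_intros d\<phi> dh refl)+ (simp add: \<phi>0 h0)
  moreover have "((\<lambda>z. \<phi> z * (h z)\<^sup>2) has_field_derivative 0) (at 0)"
    by (rule has_field_derivative_transform_within_open[where f = "\<lambda>z. 1" and S = "ball 0 1"])
       (auto simp: \<phi>h)
  ultimately have "deriv \<phi> 0 + 2 * deriv h 0 = 0" by (rule DERIV_unique)
  then have "deriv \<phi> 0 = - 2 * k 0" using k(3) by (simp add: eq_neg_iff_add_eq_0)
  with \<open>cmod (k 0) \<le> 1\<close> show ?thesis by (simp add: norm_mult)
qed

text \<open>If f z = z * \<phi> z omits w, then w * f / (w - f) is again univalent and normalised,
  and its second coefficient exceeds that of f by 1 / w. Both coefficients are at most 2 in modulus,
  so |1 / w| is at most 4.\<close>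

lemma koebe_quarter_unit_disc:
  fixes \<phi> :: "complex \<Rightarrow> complex"
  assumes \<phi>: "\<phi> holomorphic_on ball 0 1" and \<phi>0: "\<phi> 0 = 1"
    and inj: "inj_on (\<lambda>z. z * \<phi> z) (ball 0 1)"
  shows "ball 0 (1/4) \<subseteq> (\<lambda>z. z * \<phi> z) ` ball 0 1"
proof
  fix w :: complex assume w: "w \<in> ball 0 (1/4)"
  show "w \<in> (\<lambda>z. z * \<phi> z) ` ball 0 1"
  proof (rule ccontr)
    assume om: "w \<notin> (\<lambda>z. z * \<phi> z) ` ball 0 1"
    then have ne: "z * \<phi> z \<noteq> w" if "z \<in> ball 0 1" for z using that by auto
    have "w \<noteq> 0" using ne[of 0] by auto
    define \<theta> where "\<theta> = (\<lambda>z. w * \<phi> z / (w - z * \<phi> z))"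
    have \<theta>: "\<theta> holomorphic_on ball 0 1"
      unfolding \<theta>_def using ne by (intro holomorphic_intros \<phi>) (metis eq_iff_diff_eq_0)
    have \<theta>0: "\<theta> 0 = 1" using \<open>w \<noteq> 0\<close> \<phi>0 by (simp add: \<theta>_def)
    have "inj_on (\<lambda>z. z * \<theta> z) (ball 0 1)"
    proof (rule inj_onI)
      fix x y assume xy: "x \<in> ball 0 1" "y \<in> ball 0 1" and eq: "x * \<theta> x = y * \<theta> y"
      have ne': "w - x * \<phi> x \<noteq> 0" "w - y * \<phi> y \<noteq> 0" using ne xy by (metis eq_iff_diff_eq_0)+
      have "w * (x * \<phi> x) / (w - x * \<phi> x) = w * (y * \<phi> y) / (w - y * \<phi> y)"
        using eq by (simp add: \<theta>_def mult_ac)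
      then have "w * (x * \<phi> x) * (w - y * \<phi> y) = w * (y * \<phi> y) * (w - x * \<phi> x)"
        using ne' by (simp add: frac_eq_eq)
      then have "w * w * (x * \<phi> x) = w * w * (y * \<phi> y)" by (simp add: algebra_simps)
      then have "x * \<phi> x = y * \<phi> y" using \<open>w \<noteq> 0\<close> by simp
      then show "x = y" using inj_onD[OF inj, of x y] xy by simp
    qed
    then have b1: "cmod (deriv \<theta> 0) \<le> 2" by (rule bieberbach_second_coefficient[OF \<theta> \<theta>0])
    have b2: "cmod (deriv \<phi> 0) \<le> 2" by (rule bieberbach_second_coefficient[OF \<phi> \<phi>0 inj])
    have "(\<phi> has_field_derivative deriv \<phi> 0) (at 0)"
      using \<phi> by (auto intro: holomorphic_derivI)
    then have "(\<theta> has_field_derivative deriv \<phi> 0 + 1 / w) (at 0)"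
      unfolding \<theta>_def using \<open>w \<noteq> 0\<close> \<phi>0
      by (auto intro!: derivative_eq_intros simp: field_simps power2_eq_square)
    then have "1 / w = deriv \<theta> 0 - deriv \<phi> 0" by (simp add: DERIV_imp_deriv)
    then have "cmod (1 / w) \<le> 2 + 2"
      using norm_triangle_ineq4[of "deriv \<theta> 0" "deriv \<phi> 0"] b1 b2 by simp
    then have "1 / 4 \<le> cmod w" using \<open>w \<noteq> 0\<close> by (simp add: norm_divide field_simps)
    then show False using w by simp
  qed
qed

theorem koebe_quarter:
  fixes f :: "complex \<Rightarrow> complex"
  assumes f: "f holomorphic_on ball a R" and inj: "inj_on f (ball a R)" and R: "R > 0"
  shows "ball (f a) (cmod (deriv f a) * R / 4) \<subseteq> f ` ball a R"
proof
  define D where "D = deriv f a"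
  have D: "D \<noteq> 0" unfolding D_def using R by (intro holomorphic_injective_imp_regular[OF f _ inj]) auto
  have sub: "a + of_real R * z \<in> ball a R" if "z \<in> ball 0 1" for z
    using that R by (simp add: dist_norm norm_mult)
  define g where "g = (\<lambda>z. (f (a + of_real R * z) - f a) / (of_real R * D))"
  have g: "g holomorphic_on ball 0 1"
    unfolding g_def using sub R D
    by (intro holomorphic_intros holomorphic_on_compose_gen[OF _ f, unfolded o_def]) auto
  obtain \<phi> where \<phi>: "\<phi> holomorphic_on ball 0 1" "\<And>z. g z = g 0 + z * \<phi> z" "\<phi> 0 = deriv g 0"
    using holomorphic_split_off_linear[OF g open_ball] by metis
  have g\<phi>: "g = (\<lambda>z. z * \<phi> z)" using \<phi>(2) by (auto simp: g_def)
  have "(f has_field_derivative D) (at (a + of_real R * 0))"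
    unfolding D_def using R by (auto intro: holomorphic_derivI[OF f])
  then have "((\<lambda>z. f (a + of_real R * z)) has_field_derivative D * of_real R) (at 0)"
    by (rule DERIV_chain2) (auto intro!: derivative_eq_intros)
  then have "(g has_field_derivative 1) (at 0)"
    unfolding g_def using R D by (auto intro!: derivative_eq_intros)
  then have \<phi>0: "\<phi> 0 = 1" using \<phi>(3) by (simp add: DERIV_imp_deriv)
  have "inj_on g (ball 0 1)"
  proof (rule inj_onI)
    fix x y assume xy: "x \<in> ball 0 1" "y \<in> ball 0 1" and "g x = g y"
    then have "f (a + of_real R * x) = f (a + of_real R * y)" using R D by (simp add: g_def)
    then have "a + of_real R * x = a + of_real R * y" by (rule inj_onD[OF inj]) (use sub xy in auto)
    then show "x = y" using R by simp
  qed
  then have "ball 0 (1/4) \<subseteq> g ` ball 0 1"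
    using koebe_quarter_unit_disc[OF \<phi>(1) \<phi>0] unfolding g\<phi> by simp
  fix w assume w: "w \<in> ball (f a) (cmod (deriv f a) * R / 4)"
  have "(w - f a) / (of_real R * D) \<in> ball 0 (1/4)"
    using w R D by (simp add: dist_norm norm_divide norm_mult norm_minus_commute D_def field_simps)
  then obtain z where z: "z \<in> ball 0 1" "(w - f a) / (of_real R * D) = g z"
    using \<open>ball 0 (1/4) \<subseteq> g ` ball 0 1\<close> by blast
  then have "w = f (a + of_real R * z)" using R D by (simp add: g_def)
  then show "w \<in> f ` ball a R" using sub[OF z(1)] by blast
qed

text \<open>The radius of the covered disc grows linearly with that of the source disc. This is what
  excludes the whole plane as a conformal image of a proper domain.\<close>

corollary injective_entire_surj:
  fixes f :: "complex \<Rightarrow> complex"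
  assumes f: "f holomorphic_on UNIV" and inj: "inj f"
  shows "surj f"
proof -
  have "w \<in> range f" for w
  proof -
    have D: "deriv f 0 \<noteq> 0" by (rule holomorphic_injective_imp_regular[OF f open_UNIV inj]) auto
    \<comment> \<open>The covered disc then has radius \<open>dist (f 0) w + 1\<close>; the summand
      1 puts \<open>w\<close> strictly inside.\<close>
    define R where "R = 4 * (dist (f 0) w + 1) / cmod (deriv f 0)"
    have "R > 0" using D by (auto simp: R_def intro!: divide_pos_pos add_nonneg_pos)
    moreover have "w \<in> ball (f 0) (cmod (deriv f 0) * R / 4)" using D by (simp add: R_def)
    moreover have "f holomorphic_on ball 0 R" "inj_on f (ball 0 R)"
      using f inj by (auto intro: holomorphic_on_subset inj_on_subset)
    ultimately show ?thesis
      using koebe_quarter[of f 0 R] by blast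
  qed
  then show ?thesis by auto
qed

section \<open>Arc length\<close>

lemma polygon_lengthsI:
  assumes "t 0 = a" "t n = b" "\<And>i. i < n \<Longrightarrow> t i \<le> t (Suc i)"
  shows "(\<Sum>i<n. dist (g (t i)) (g (t (Suc i)))) \<in> polygon_lengths g a b"
  using assms unfolding polygon_lengths_def by blast

lemma polygon_lengthsE:
  assumes "p \<in> polygon_lengths g a b"
  obtains t n where "t 0 = a" "t n = b" "\<And>i. i < n \<Longrightarrow> t i \<le> t (Suc i)"
    "p = (\<Sum>i<n. dist (g (t i)) (g (t (Suc i))))" "\<And>i. i \<le> n \<Longrightarrow> t i \<in> {a..b}"
proof -
  obtain t n where t: "t 0 = a" "t n = b" "\<And>i. i < n \<Longrightarrow> t i \<le> t (Suc i)"
    "p = (\<Sum>i<n. dist (g (t i)) (g (t (Suc i))))"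
    using assms unfolding polygon_lengths_def by blast
  have mono: "t i \<le> t j" if "i \<le> j" "j \<le> n" for i j
    using that
  proof (induction j rule: dec_induct)
    case (step k)
    then show ?case using t(3)[of k] by auto
  qed auto
  have "t i \<in> {a..b}" if "i \<le> n" for i
    using mono[of 0 i] mono[of i n] that t by auto
  with t show thesis using that by blast
qed

lemma dist_mem_polygon_lengths:
  assumes "a \<le> b" shows "dist (g a) (g b) \<in> polygon_lengths g a b"
  using polygon_lengthsI[of "\<lambda>i. if i = 0 then a else b" a 1 b g] assms by simp

lemma polygon_lengths_nonneg: "p \<in> polygon_lengths g a b \<Longrightarrow> 0 \<le> p"
  unfolding polygon_lengths_def by (auto intro: sum_nonneg)

lemma polygon_lengths_add:
  assumes "p \<in> polygon_lengths g a b" "q \<in> polygon_lengths g b c"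
  shows "p + q \<in> polygon_lengths g a c"
proof -
  obtain t n where t: "t 0 = a" "t n = b" "\<And>i. i < n \<Longrightarrow> t i \<le> t (Suc i)"
    "p = (\<Sum>i<n. dist (g (t i)) (g (t (Suc i))))"
    using assms(1) by (rule polygon_lengthsE) auto
  obtain u m where u: "u 0 = b" "u m = c" "\<And>i. i < m \<Longrightarrow> u i \<le> u (Suc i)"
    "q = (\<Sum>i<m. dist (g (u i)) (g (u (Suc i))))"
    using assms(2) by (rule polygon_lengthsE) auto
  define v where "v = (\<lambda>i. if i \<le> n then t i else u (i - n))"
  have v1: "v i = t i" if "i \<le> n" for i using that by (simp add: v_def)
  have v2: "v (n + i) = u i" for i using t u by (cases i) (auto simp: v_def)
  have "p + q = (\<Sum>i<n + m. dist (g (v i)) (g (v (Suc i))))"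
  proof -
    have "(\<Sum>i<n + m. dist (g (v i)) (g (v (Suc i))))
        = (\<Sum>i<n. dist (g (v i)) (g (v (Suc i)))) + (\<Sum>i<m. dist (g (v (n + i))) (g (v (n + Suc i))))"
      by (induction m) (auto simp: add.assoc)
    also have "(\<Sum>i<n. dist (g (v i)) (g (v (Suc i)))) = p"
      unfolding t(4) by (intro sum.cong) (auto simp: v1)
    finally show ?thesis unfolding u(4) v2 by simp
  qed
  moreover have "(\<Sum>i<n + m. dist (g (v i)) (g (v (Suc i)))) \<in> polygon_lengths g a c"
  proof (rule polygon_lengthsI)
    show "v 0 = a" "v (n + m) = c" using t u v1[of 0] v2[of m] by auto
    fix i assume i: "i < n + m"
    show "v i \<le> v (Suc i)"
    proof (cases "i < n")
      case True
      then show ?thesis using t v1 by simp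
    next
      case False
      then obtain j where "i = n + j" "j < m" using i by (metis add_less_cancel_left le_Suc_ex not_less)
      then show ?thesis using u(3)[of j] v2[of j] v2[of "Suc j"] by simp
    qed
  qed
  ultimately show ?thesis by simp
qed

text \<open>Cutting every vertex parameter of a polygon off at \<open>b\<close>, from above and from below, splits the
  polygon at \<open>b\<close>.\<close>

lemma polygon_cut_le:
  fixes t :: "nat \<Rightarrow> real"
  assumes "\<And>i. i < n \<Longrightarrow> t i \<le> t (Suc i)"
  shows "(\<Sum>i<n. dist (g (t i)) (g (t (Suc i)))) \<le>
     (\<Sum>i<n. dist (g (min (t i) b)) (g (min (t (Suc i)) b)))
     + (\<Sum>i<n. dist (g (max (t i) b)) (g (max (t (Suc i)) b)))"
  unfolding sum.distrib[symmetric]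
proof (rule sum_mono)
  fix i assume "i \<in> {..<n}"
  then have "t i \<le> t (Suc i)" using assms by simp
  then show "dist (g (t i)) (g (t (Suc i))) \<le> dist (g (min (t i) b)) (g (min (t (Suc i)) b))
     + dist (g (max (t i) b)) (g (max (t (Suc i)) b))"
    by (cases "t i \<le> b"; cases "t (Suc i) \<le> b") (auto simp: min_def max_def dist_triangle)
qed

lemma polygon_cut_mem:
  fixes t :: "nat \<Rightarrow> real"
  assumes "t 0 = a" "t n = c" "\<And>i. i < n \<Longrightarrow> t i \<le> t (Suc i)" "a \<le> b" "b \<le> c"
  shows "(\<Sum>i<n. dist (g (min (t i) b)) (g (min (t (Suc i)) b))) \<in> polygon_lengths g a b"
    "(\<Sum>i<n. dist (g (max (t i) b)) (g (max (t (Suc i)) b))) \<in> polygon_lengths g b c"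
  using assms by (intro polygon_lengthsI[of "\<lambda>i. min (t i) b"] polygon_lengthsI[of "\<lambda>i. max (t i) b"];
      force simp: min_def max_def)+

abbreviation rectifiable_on :: "(real \<Rightarrow> 'a::metric_space) \<Rightarrow> real \<Rightarrow> real \<Rightarrow> bool" where
  "rectifiable_on g a b \<equiv> bdd_above (polygon_lengths g a b)"

text \<open>A polygon over the inner interval is completed by the chords over the two outer
  ones.\<close>

lemma rectifiable_on_subinterval:
  assumes "rectifiable_on g a d" "a \<le> b" "b \<le> c" "c \<le> d"
  shows "rectifiable_on g b c"
proof -
  obtain K where K: "\<And>p. p \<in> polygon_lengths g a d \<Longrightarrow> p \<le> K"
    using assms unfolding bdd_above_def by auto
  have "p \<le> K" if "p \<in> polygon_lengths g b c" for p
  proof -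
    have "dist (g a) (g b) + p + dist (g c) (g d) \<in> polygon_lengths g a d"
      using that assms by (intro polygon_lengths_add[where b = c] polygon_lengths_add[where b = b] dist_mem_polygon_lengths)
    from K[OF this] show ?thesis using zero_le_dist[of "g a" "g b"] zero_le_dist[of "g c" "g d"] by linarith
  qed
  then show ?thesis by (rule bdd_aboveI)
qed

lemma rectifiable_on_combine:
  assumes "rectifiable_on g a b" "rectifiable_on g b c" "a \<le> b" "b \<le> c"
  shows "rectifiable_on g a c"
proof -
  obtain K where K: "\<And>p. p \<in> polygon_lengths g a b \<Longrightarrow> p \<le> K" using assms(1) unfolding bdd_above_def by auto
  obtain L where L: "\<And>p. p \<in> polygon_lengths g b c \<Longrightarrow> p \<le> L" using assms(2) unfolding bdd_above_def by auto
  have "p \<le> K + L" if "p \<in> polygon_lengths g a c" for p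
    using that
  proof (rule polygon_lengthsE)
    fix t n assume t: "t 0 = a" "t n = c" "\<And>i. i < n \<Longrightarrow> t i \<le> t (Suc i)"
      and p: "p = (\<Sum>i<n. dist (g (t i)) (g (t (Suc i))))"
    show ?thesis
      using polygon_cut_le[of n t g b, OF t(3)] K[OF polygon_cut_mem(1)[OF t assms(3,4)]]
        L[OF polygon_cut_mem(2)[OF t assms(3,4)]] unfolding p by linarith
  qed
  then show ?thesis by (rule bdd_aboveI)
qed

lemma curve_length_ge:
  "rectifiable_on g a b \<Longrightarrow> p \<in> polygon_lengths g a b \<Longrightarrow> p \<le> curve_length g a b"
  unfolding curve_length_def by (rule cSup_upper)

lemma curve_length_le:
  assumes "a \<le> b" "\<And>p. p \<in> polygon_lengths g a b \<Longrightarrow> p \<le> K"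
  shows "curve_length g a b \<le> K"
  unfolding curve_length_def using assms dist_mem_polygon_lengths[OF assms(1)] by (intro cSup_least) auto

lemma dist_le_curve_length:
  "rectifiable_on g a b \<Longrightarrow> a \<le> b \<Longrightarrow> dist (g a) (g b) \<le> curve_length g a b"
  by (intro curve_length_ge dist_mem_polygon_lengths)

lemma curve_length_nonneg:
  "rectifiable_on g a b \<Longrightarrow> a \<le> b \<Longrightarrow> 0 \<le> curve_length g a b"
  using dist_le_curve_length zero_le_dist order_trans by blast

lemma curve_length_add:
  assumes "rectifiable_on g a c" "a \<le> b" "b \<le> c"
  shows "curve_length g a c = curve_length g a b + curve_length g b c"
proof (rule antisym)
  have r: "rectifiable_on g a b" "rectifiable_on g b c"
    using assms by (auto intro: rectifiable_on_subinterval)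
  show "curve_length g a c \<le> curve_length g a b + curve_length g b c"
  proof (rule curve_length_le)
    fix p assume "p \<in> polygon_lengths g a c"
    then show "p \<le> curve_length g a b + curve_length g b c"
    proof (rule polygon_lengthsE)
      fix t n assume t: "t 0 = a" "t n = c" "\<And>i. i < n \<Longrightarrow> t i \<le> t (Suc i)"
        and p: "p = (\<Sum>i<n. dist (g (t i)) (g (t (Suc i))))"
      show ?thesis
        using polygon_cut_le[of n t g b, OF t(3)] curve_length_ge[OF r(1) polygon_cut_mem(1)[OF t assms(2,3)]]
          curve_length_ge[OF r(2) polygon_cut_mem(2)[OF t assms(2,3)]] unfolding p by linarith
    qed
  qed (use assms in auto)
  have "p + q \<le> curve_length g a c" if "p \<in> polygon_lengths g a b" "q \<in> polygon_lengths g b c" for p q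
    by (rule curve_length_ge[OF assms(1) polygon_lengths_add[OF that]])
  then have "p \<le> curve_length g a c - q" if "p \<in> polygon_lengths g a b" "q \<in> polygon_lengths g b c" for p q
    using that by (simp add: le_diff_eq)
  then have "curve_length g a b \<le> curve_length g a c - q" if "q \<in> polygon_lengths g b c" for q
    using that assms by (intro curve_length_le) auto
  then have "q \<le> curve_length g a c - curve_length g a b" if "q \<in> polygon_lengths g b c" for q
    using that by (simp add: algebra_simps)
  then have "curve_length g b c \<le> curve_length g a c - curve_length g a b"
    using assms by (intro curve_length_le) auto
  then show "curve_length g a b + curve_length g b c \<le> curve_length g a c" by simp
qed

lemma polygon_lengths_lipschitz_le:
  assumes lip: "\<And>u v. u \<in> {a..b} \<Longrightarrow> v \<in> {a..b} \<Longrightarrow> dist (h u) (h v) \<le> K * dist (g u) (g v)"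
    and p: "p \<in> polygon_lengths h a b"
  obtains q where "q \<in> polygon_lengths g a b" "p \<le> K * q"
proof -
  obtain t n where t: "t 0 = a" "t n = b" "\<And>i. i < n \<Longrightarrow> t i \<le> t (Suc i)"
    "p = (\<Sum>i<n. dist (h (t i)) (h (t (Suc i))))" "\<And>i. i \<le> n \<Longrightarrow> t i \<in> {a..b}"
    using p by (rule polygon_lengthsE) blast
  have "p \<le> K * (\<Sum>i<n. dist (g (t i)) (g (t (Suc i))))"
    unfolding t(4) sum_distrib_left using t(5) by (intro sum_mono lip) auto
  with polygon_lengthsI[of t, OF t(1-3)] show thesis using that by blast
qed

lemma curve_length_lipschitz_le:
  assumes lip: "\<And>u v. u \<in> {a..b} \<Longrightarrow> v \<in> {a..b} \<Longrightarrow> dist (h u) (h v) \<le> K * dist (g u) (g v)"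
    and g: "rectifiable_on g a b" and K: "K \<ge> 0" and ab: "a \<le> b"
  shows "rectifiable_on h a b" "curve_length h a b \<le> K * curve_length g a b"
proof -
  have *: "p \<le> K * curve_length g a b" if p: "p \<in> polygon_lengths h a b" for p
  proof -
    obtain q where "q \<in> polygon_lengths g a b" "p \<le> K * q"
      using polygon_lengths_lipschitz_le[of a b h K g p] lip p by blast
    then show ?thesis using mult_left_mono[OF curve_length_ge[OF g] K] by force
  qed
  then show "rectifiable_on h a b" by (rule bdd_aboveI)
  show "curve_length h a b \<le> K * curve_length g a b" by (rule curve_length_le[OF ab *])
qed

text \<open>The identity serves as reference curve: a Lipschitz path is one that is Lipschitz
  relative to it, so \<open>curve_length_lipschitz_le\<close> applies.\<close>

lemma curve_length_id:
  fixes a b :: real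
  assumes "a \<le> b"
  shows "rectifiable_on (\<lambda>x::real. x) a b" "curve_length (\<lambda>x::real. x) a b = b - a"
proof -
  have *: "p = b - a" if p: "p \<in> polygon_lengths (\<lambda>x::real. x) a b" for p
  proof -
    obtain t n where t: "t 0 = a" "t n = b" "\<And>i. i < n \<Longrightarrow> t i \<le> t (Suc i)"
      "p = (\<Sum>i<n. dist (t i) (t (Suc i)))"
      using p by (rule polygon_lengthsE) blast
    have "p = (\<Sum>i<n. t (Suc i) - t i)" unfolding t(4) using t(3) by (intro sum.cong) (auto simp: dist_real_def)
    also have "\<dots> = b - a" by (simp add: sum_lessThan_telescope t)
    finally show ?thesis .
  qed
  show r: "rectifiable_on (\<lambda>x::real. x) a b" by (rule bdd_aboveI[where M = "b - a"]) (use * in fastforce)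
  show "curve_length (\<lambda>x::real. x) a b = b - a"
    using dist_le_curve_length[OF r assms] curve_length_le[OF assms, of "\<lambda>x. x" "b - a"] * assms
    by (force simp: dist_real_def)
qed

text \<open>Fix a polygon over \<open>{x..b}\<close> whose length is within e / 2 of the supremum
  and cut it at \<open>u\<close>. By continuity of \<open>g\<close> the part before \<open>u\<close>
  becomes shorter than e / 2 as \<open>u\<close> decreases to \<open>x\<close>, so almost the whole
  length lies beyond \<open>u\<close> and the arc over \<open>{x..u}\<close> is shorter than
  e.\<close>

lemma curve_length_right_continuous:
  fixes g :: "real \<Rightarrow> 'a::metric_space"
  assumes g: "rectifiable_on g a b" "continuous_on {a..b} g" and x: "a \<le> x" "x < b"
  shows "((\<lambda>u. curve_length g a u) \<longlongrightarrow> curve_length g a x) (at_right x)"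
proof (rule tendstoI)
  fix e :: real assume e: "e > 0"
  have rx: "rectifiable_on g x b" using g x by (auto intro: rectifiable_on_subinterval)
  have "curve_length g x b - e / 2 < curve_length g x b" using e by simp
  then obtain p where p: "p \<in> polygon_lengths g x b" "curve_length g x b - e / 2 < p"
    unfolding curve_length_def using dist_mem_polygon_lengths[of x b g] x by (metis less_cSupE less_imp_le empty_iff)
  obtain t n where t: "t 0 = x" "t n = b" "\<And>i. i < n \<Longrightarrow> t i \<le> t (Suc i)"
    "p = (\<Sum>i<n. dist (g (t i)) (g (t (Suc i))))" "\<And>i. i \<le> n \<Longrightarrow> t i \<in> {x..b}"
    using p(1) by (rule polygon_lengthsE) blast
  let ?S = "\<lambda>u. \<Sum>i<n. dist (g (min (t i) u)) (g (min (t (Suc i)) u))"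
  have lim: "((\<lambda>u. g (min (t i) u)) \<longlongrightarrow> g x) (at_right x)" if "i \<le> n" for i
  proof -
    have "((\<lambda>u. min (t i) u) \<longlongrightarrow> min (t i) x) (at_right x)" by (intro tendsto_intros)
    moreover have "min (t i) x = x" using t(5)[OF that] by simp
    moreover have "\<forall>\<^sub>F u in at_right x. min (t i) u \<in> {a..b}"
      using eventually_at_right_less[of x]
      by eventually_elim (use t(5)[OF that] x in auto)
    ultimately show ?thesis
      using continuous_on_tendsto_compose[OF g(2), of "\<lambda>u. min (t i) u" x] x by auto
  qed
  have "(?S \<longlongrightarrow> (\<Sum>i<n. dist (g x) (g x))) (at_right x)"
    by (intro tendsto_sum tendsto_dist lim) auto
  then have "\<forall>\<^sub>F u in at_right x. ?S u < e / 2"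
    using e by (intro order_tendstoD(2)[of ?S 0]) auto
  moreover have "\<forall>\<^sub>F u in at_right x. x < u" by (rule eventually_at_right_less)
  moreover have "\<forall>\<^sub>F u in at_right x. u < b" using x by (auto simp: eventually_at_right_field)
  ultimately show "\<forall>\<^sub>F u in at_right x. dist (curve_length g a u) (curve_length g a x) < e"
  proof eventually_elim
    case (elim u)
    have xu: "x \<le> u" "u \<le> b" using elim by auto
    have ru: "rectifiable_on g u b" "rectifiable_on g x u" "rectifiable_on g a u" 
      using g x xu by (auto intro: rectifiable_on_subinterval)
    have "p \<le> ?S u + curve_length g u b"
      using polygon_cut_le[of n t g u, OF t(3)] curve_length_ge[OF ru(1) polygon_cut_mem(2)[OF t(1-3) xu]]
      unfolding t(4) by linarith
    moreover have "curve_length g x b = curve_length g x u + curve_length g u b"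
      using rx xu by (rule curve_length_add)
    ultimately have "curve_length g x u < e" using elim p(2) by linarith
    moreover have "curve_length g a u = curve_length g a x + curve_length g x u"
      using ru(3) x(1) xu(1) by (rule curve_length_add)
    ultimately show ?case using curve_length_nonneg[OF ru(2) xu(1)] by (simp add: dist_real_def)
  qed
qed

section \<open>The arc length measure of a rectifiable path\<close>

context
  fixes g :: "real \<Rightarrow> 'a::metric_space"
  assumes rect: "rectifiable_path g"
begin

lemma rectifiable_path_subinterval: "0 \<le> s \<Longrightarrow> s \<le> t \<Longrightarrow> t \<le> 1 \<Longrightarrow> rectifiable_on g s t"
  using rect unfolding rectifiable_path_def by (auto intro: rectifiable_on_subinterval[of g 0 1])

lemma emeasure_arclength_Ioc:
  assumes "s \<le> t"
  shows "emeasure (arclength_measure g) {s<..t}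
     = ennreal (curve_length g 0 (max 0 (min 1 t)) - curve_length g 0 (max 0 (min 1 s)))"
  unfolding arclength_measure_def
proof (rule emeasure_interval_measure_Ioc[OF assms])
  let ?c = "\<lambda>t. max 0 (min 1 t) :: real"
  fix x y :: real assume "x \<le> y"
  then have xy: "0 \<le> ?c x" "?c x \<le> ?c y" "?c y \<le> 1" by auto
  then have "curve_length g 0 (?c y) = curve_length g 0 (?c x) + curve_length g (?c x) (?c y)"
    by (intro curve_length_add rectifiable_path_subinterval) auto
  then show "curve_length g 0 (?c x) \<le> curve_length g 0 (?c y)"
    using curve_length_nonneg[OF rectifiable_path_subinterval[OF xy] xy(2)] by simp
next
  let ?c = "\<lambda>t. max 0 (min 1 t) :: real"
  fix x :: real
  show "continuous (at_right x) (\<lambda>t. curve_length g 0 (?c t))"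
    unfolding continuous_within
  proof (cases "x < 0 \<or> 1 \<le> x")
    \<comment> \<open>Immediately to the right of such an \<open>x\<close> the clamped parameter is
      constant.\<close>
    case True
    have "\<forall>\<^sub>F y in at_right x. y < (if x < 0 then 0 else x + 1)"
      by (cases "x < 0") (auto simp: eventually_at_right_field intro: exI[of _ 0] exI[of _ "x + 1"])
    moreover have "\<forall>\<^sub>F y in at_right x. x < y" by (rule eventually_at_right_less)
    ultimately have "\<forall>\<^sub>F y in at_right x. curve_length g 0 (?c x) = curve_length g 0 (?c y)"
    proof eventually_elim
      case (elim y)
      have "?c y = ?c x" using True elim by (cases "x < 0") auto
      then show ?case by simp
    qed
    then show "((\<lambda>t. curve_length g 0 (?c t)) \<longlongrightarrow> curve_length g 0 (?c x)) (at_right x)"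
      by (rule tendsto_eventually[OF eventually_mono]) simp
  next
    case False
    then have x: "0 \<le> x" "x < 1" by auto
    have "((\<lambda>t. curve_length g 0 t) \<longlongrightarrow> curve_length g 0 x) (at_right x)"
      using rect x unfolding rectifiable_path_def path_def
      by (intro curve_length_right_continuous[where b = 1]) auto
    moreover have "\<forall>\<^sub>F y in at_right x. curve_length g 0 y = curve_length g 0 (?c y)"
    proof -
      have "\<forall>\<^sub>F y in at_right x. y < 1" using x by (auto simp: eventually_at_right_field)
      moreover have "\<forall>\<^sub>F y in at_right x. x < y" by (rule eventually_at_right_less)
      ultimately show ?thesis by eventually_elim (use x in auto)
    qed
    ultimately have "((\<lambda>t. curve_length g 0 (?c t)) \<longlongrightarrow> curve_length g 0 x) (at_right x)"
      by (rule Lim_transform_eventually)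
    then show "((\<lambda>t. curve_length g 0 (?c t)) \<longlongrightarrow> curve_length g 0 (?c x)) (at_right x)"
      using x by simp
  qed
qed

lemma measure_arclength_Ioc:
  assumes "0 \<le> s" "s \<le> t" "t \<le> 1"
  shows "measure (arclength_measure g) {s<..t} = curve_length g s t"
    "emeasure (arclength_measure g) {s<..t} < \<infinity>"
proof -
  have "curve_length g 0 t = curve_length g 0 s + curve_length g s t"
    using assms by (intro curve_length_add rectifiable_path_subinterval) auto
  then have "emeasure (arclength_measure g) {s<..t} = ennreal (curve_length g s t)"
    using assms emeasure_arclength_Ioc[OF assms(2)] by simp
  then show "measure (arclength_measure g) {s<..t} = curve_length g s t"
      "emeasure (arclength_measure g) {s<..t} < \<infinity>"
    using curve_length_nonneg[OF rectifiable_path_subinterval[OF assms] assms(2)]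
    by (auto simp: measure_def)
qed

lemma sets_arclength_measure [simp, measurable_cong]: "sets (arclength_measure g) = sets borel"
  by (simp add: arclength_measure_def)

text \<open>The constant extension to the left of 0 leaves no atom at 0. Hence the closed interval
  in \<open>arclength_integral\<close> can be exchanged for a half-open one, and half-open intervals
  fit together without overlap.\<close>

lemma arclength_null_0: "{0} \<in> null_sets (arclength_measure g)"
proof -
  have "emeasure (arclength_measure g) {0} \<le> emeasure (arclength_measure g) {-1<..0}"
    by (rule emeasure_mono) auto
  also have "\<dots> = 0" by (subst emeasure_arclength_Ioc) auto
  finally show ?thesis by (simp add: null_sets_def)
qed

context
  fixes \<phi> :: "real \<Rightarrow> real"
  assumes \<phi>: "continuous_on {0..1} \<phi>"
begin

lemma set_integrable_arclength:
  assumes "0 \<le> s" "s \<le> t" "t \<le> 1"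
  shows "set_integrable (arclength_measure g) {s<..t} \<phi>"
proof -
  have "compact (\<phi> ` {0..1})" using \<phi> by (intro compact_continuous_image) auto
  then obtain B where "\<forall>y\<in>\<phi> ` {0..1}. norm y \<le> B"
    using compact_imp_bounded[of "\<phi> ` {0..1}"] unfolding bounded_iff by blast
  then have B: "\<And>x. x \<in> {0..1} \<Longrightarrow> norm (\<phi> x) \<le> B" by blast
  \<comment> \<open>Nothing is known about \<open>\<phi>\<close> outside the unit interval; the
    cut-off makes it Borel measurable on the line.\<close>
  have "(\<lambda>x. indicator {0..1} x *\<^sub>R \<phi> x) \<in> borel_measurable borel"
    using \<phi> by (intro borel_measurable_continuous_on_indicator) auto
  then have meas: "(\<lambda>x. indicator {0..1} x *\<^sub>R \<phi> x) \<in> borel_measurable (arclength_measure g)"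
    by simp
  have "set_integrable (arclength_measure g) {s<..t} (\<lambda>x. indicator {0..1} x *\<^sub>R \<phi> x)"
    unfolding set_integrable_def
    using measure_arclength_Ioc(2)[OF assms] B assms
    by (intro integrableI_bounded_set_indicator[OF _ meas, of _ B]) (auto intro!: AE_I2)
  then show ?thesis
    by (rule set_integrable_cong[THEN iffD1, rotated 3]) (use assms in auto)
qed

lemma arclength_integral_bounds:
  assumes st: "0 \<le> s" "s \<le> t" "t \<le> 1"
  shows "(\<And>x. x \<in> {s..t} \<Longrightarrow> m \<le> \<phi> x) \<Longrightarrow> m * curve_length g s t \<le> (LINT x:{s<..t}|arclength_measure g. \<phi> x)"
    and "(\<And>x. x \<in> {s..t} \<Longrightarrow> \<phi> x \<le> m) \<Longrightarrow> (LINT x:{s<..t}|arclength_measure g. \<phi> x) \<le> m * curve_length g s t"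
proof -
  note int = set_integrable_arclength[OF st]
  have c: "set_integrable (arclength_measure g) {s<..t} (\<lambda>x. m)"
    "(LINT x:{s<..t}|arclength_measure g. m) = m * curve_length g s t"
    using measure_arclength_Ioc[OF st] by (auto simp: set_integrable_def set_lebesgue_integral_def)
  show "(\<And>x. x \<in> {s..t} \<Longrightarrow> m \<le> \<phi> x) \<Longrightarrow> m * curve_length g s t \<le> (LINT x:{s<..t}|arclength_measure g. \<phi> x)"
    unfolding c(2)[symmetric] by (rule set_integral_mono[OF c(1) int]) auto
  show "(\<And>x. x \<in> {s..t} \<Longrightarrow> \<phi> x \<le> m) \<Longrightarrow> (LINT x:{s<..t}|arclength_measure g. \<phi> x) \<le> m * curve_length g s t"
    unfolding c(2)[symmetric] by (rule set_integral_mono[OF int c(1)]) auto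
qed

lemma arclength_integral_Ioc_add:
  assumes "0 \<le> s" "s \<le> t" "t \<le> u" "u \<le> 1"
  shows "(LINT x:{s<..u}|arclength_measure g. \<phi> x)
    = (LINT x:{s<..t}|arclength_measure g. \<phi> x) + (LINT x:{t<..u}|arclength_measure g. \<phi> x)"
proof -
  have "{s<..u} = {s<..t} \<union> {t<..u}" using assms by auto
  then show ?thesis
    using assms set_integrable_arclength[of s t] set_integrable_arclength[of t u]
    by (simp add: set_integral_Un)
qed

lemma arclength_integral_Icc_eq_Ioc:
  "(LINT x:{0..1}|arclength_measure g. \<phi> x) = (LINT x:{0<..1}|arclength_measure g. \<phi> x)"
proof -
  have "AE x in arclength_measure g. x \<noteq> 0"
    using AE_not_in[OF arclength_null_0] by simp
  then have ae: "AE x in arclength_measure g. indicator {0<..1} x *\<^sub>R \<phi> x = indicator {0..1} x *\<^sub>R \<phi> x"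
    by (rule eventually_mono) (auto simp: indicator_def)
  have "(\<lambda>x. indicator {0..1} x *\<^sub>R \<phi> x) \<in> borel_measurable borel"
    using \<phi> by (intro borel_measurable_continuous_on_indicator) auto
  moreover have "(\<lambda>x. indicator {0<..1} x *\<^sub>R \<phi> x) \<in> borel_measurable (arclength_measure g)"
    using set_integrable_arclength[of 0 1] unfolding set_integrable_def by (auto dest: borel_measurable_integrable)
  ultimately show ?thesis
    unfolding set_lebesgue_integral_def using ae by (intro integral_cong_AE) (auto elim: eventually_mono)
qed

end

end

section \<open>Comparison of arc length between two paths\<close>

lemma rectifiable_path_lipschitz_local:
  fixes g :: "real \<Rightarrow> 'a::metric_space" and h :: "real \<Rightarrow> 'b::metric_space"
  assumes g: "rectifiable_path g" and h: "path h"
    and loc: "\<And>x. x \<in> {0..1} \<Longrightarrow> \<exists>L\<ge>0. \<exists>d>0. \<forall>u\<in>{0..1}. \<forall>v\<in>{0..1}. \<bar>u - x\<bar> < d \<longrightarrow> \<bar>v - x\<bar> < d \<longrightarrow>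
        dist (h u) (h v) \<le> L * dist (g u) (g v)"
  shows "rectifiable_path h"
proof -
  have "0 \<le> (0::real) \<longrightarrow> (1::real) \<le> 1 \<longrightarrow> (0::real) \<le> 1 \<longrightarrow> rectifiable_on h 0 1"
  \<comment> \<open>Bisection: the property passes to the union of adjacent intervals and holds for
    short intervals around each point. The premises make it vacuous for intervals that leave the
    unit interval.\<close>
  proof (rule Bolzano[where P = "\<lambda>s t. 0 \<le> s \<longrightarrow> t \<le> 1 \<longrightarrow> s \<le> t \<longrightarrow> rectifiable_on h s t"])
    show "0 \<le> (1::real)" by simp
    show "\<And>a b c. \<lbrakk>0 \<le> a \<longrightarrow> b \<le> 1 \<longrightarrow> a \<le> b \<longrightarrow> rectifiable_on h a b;
        0 \<le> b \<longrightarrow> c \<le> 1 \<longrightarrow> b \<le> c \<longrightarrow> rectifiable_on h b c; a \<le> b; b \<le> c\<rbrakk>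
        \<Longrightarrow> 0 \<le> a \<longrightarrow> c \<le> 1 \<longrightarrow> a \<le> c \<longrightarrow> rectifiable_on h a c"
      by (auto intro: rectifiable_on_combine)
    fix x :: real assume "0 \<le> x" "x \<le> 1"
    then obtain L d where L: "L \<ge> 0" "d > 0"
      "\<And>u v. u\<in>{0..1} \<Longrightarrow> v\<in>{0..1} \<Longrightarrow> \<bar>u - x\<bar> < d \<Longrightarrow> \<bar>v - x\<bar> < d \<Longrightarrow> dist (h u) (h v) \<le> L * dist (g u) (g v)"
      using loc[of x] by auto
    show "\<exists>d>0. \<forall>a b. a \<le> x \<and> x \<le> b \<and> b - a < d \<longrightarrow> 0 \<le> a \<longrightarrow> b \<le> 1 \<longrightarrow> a \<le> b \<longrightarrow> rectifiable_on h a b"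
    proof (intro exI[of _ d] conjI allI impI L(2))
      fix a b assume ab: "a \<le> x \<and> x \<le> b \<and> b - a < d" "0 \<le> a" "b \<le> 1" "a \<le> b"
      show "rectifiable_on h a b"
        using ab by (intro curve_length_lipschitz_le(1)[OF _ rectifiable_path_subinterval[OF g] L(1)] L(3)) auto
    qed
  qed
  then show ?thesis using h by (simp add: rectifiable_path_def)
qed

text \<open>In terms of arc length elements, \<open>loc\<close> says \<open>|dh| \<le> K |dg|\<close>.\<close>

lemma arclength_integral_comparison:
  fixes g :: "real \<Rightarrow> 'a::metric_space" and h :: "real \<Rightarrow> 'b::metric_space"
  assumes g: "rectifiable_path g" and h: "rectifiable_path h"
    and \<phi>: "continuous_on {0..1} \<phi>" and \<psi>: "continuous_on {0..1} \<psi>"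
    and nn: "\<And>x. x \<in> {0..1} \<Longrightarrow> 0 \<le> \<psi> x" "\<And>x. x \<in> {0..1} \<Longrightarrow> 0 \<le> K x" "0 \<le> C"
    and loc: "\<And>x e. x \<in> {0..1} \<Longrightarrow> e > 0 \<Longrightarrow> \<exists>d>0. \<forall>u\<in>{0..1}. \<forall>v\<in>{0..1}. \<bar>u - x\<bar> < d \<longrightarrow> \<bar>v - x\<bar> < d \<longrightarrow>
        dist (h u) (h v) \<le> (K x + e) * dist (g u) (g v)"
    and weight: "\<And>x. x \<in> {0..1} \<Longrightarrow> \<psi> x * K x \<le> C * \<phi> x"
  shows "(LINT x:{0..1}|arclength_measure h. \<psi> x) \<le> C * (LINT x:{0..1}|arclength_measure g. \<phi> x)"
proof -
  define I where "I = (\<lambda>s t. LINT x:{s<..t}|arclength_measure g. \<phi> x)"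
  define J where "J = (\<lambda>s t. LINT x:{s<..t}|arclength_measure h. \<psi> x)"
  \<comment> \<open>An error proportional to length is additive over adjacent intervals, so it
    survives bisection; a fixed error per interval would not.\<close>
  have main: "J 0 1 \<le> C * I 0 1 + \<eta> * curve_length g 0 1" if \<eta>: "\<eta> > 0" for \<eta>
  proof -
    let ?P = "\<lambda>s t. 0 \<le> s \<longrightarrow> t \<le> 1 \<longrightarrow> s \<le> t \<longrightarrow> J s t \<le> C * I s t + \<eta> * curve_length g s t"
    have "?P 0 1"
    proof (rule Bolzano[where P = ?P])
      show "0 \<le> (1::real)" by simp
      fix a b c assume "?P a b" "?P b c" and abc: "a \<le> b" "b \<le> c"
      show "?P a c"
      proof (intro impI)
        assume ac: "0 \<le> a" "c \<le> 1" "a \<le> c"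
        have "J a b \<le> C * I a b + \<eta> * curve_length g a b" "J b c \<le> C * I b c + \<eta> * curve_length g b c"
          using \<open>?P a b\<close> \<open>?P b c\<close> abc ac by auto
        moreover have "J a c = J a b + J b c"
          unfolding J_def using abc ac by (intro arclength_integral_Ioc_add[OF h \<psi>])
        moreover have "I a c = I a b + I b c"
          unfolding I_def using abc ac by (intro arclength_integral_Ioc_add[OF g \<phi>])
        moreover have "curve_length g a c = curve_length g a b + curve_length g b c"
          using abc ac by (intro curve_length_add rectifiable_path_subinterval[OF g])
        ultimately show "J a c \<le> C * I a c + \<eta> * curve_length g a c" by (simp add: algebra_simps)
      qed
    next
      fix x :: real assume "0 \<le> x" "x \<le> 1"
      then have x: "x \<in> {0..1}" by simp
      \<comment> \<open>The coefficients of e in (\<psi> + e) * (K + e) - C * (\<phi> - e), where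
        e^2 is estimated by e; this is why e is at most 1 below.\<close>
      define S where "S = \<psi> x + K x + 1 + C"
      have S: "S > 0" using nn(1,2)[OF x] nn(3) by (simp add: S_def)
      define e where "e = min 1 (\<eta> / S)"
      have e: "e > 0" "e \<le> 1" "e * S \<le> \<eta>" using \<eta> S by (auto simp: e_def min_def field_simps)
      obtain d1 where d1: "d1 > 0" "\<And>u v. u\<in>{0..1} \<Longrightarrow> v\<in>{0..1} \<Longrightarrow> \<bar>u - x\<bar> < d1 \<Longrightarrow> \<bar>v - x\<bar> < d1 \<Longrightarrow>
        dist (h u) (h v) \<le> (K x + e) * dist (g u) (g v)"
        using loc[OF x e(1)] by auto
      obtain d2 where d2: "d2 > 0" "\<And>u. u \<in> {0..1} \<Longrightarrow> \<bar>u - x\<bar> < d2 \<Longrightarrow> \<bar>\<phi> u - \<phi> x\<bar> < e"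
        using \<phi> x e(1) unfolding continuous_on_iff dist_real_def by metis
      obtain d3 where d3: "d3 > 0" "\<And>u. u \<in> {0..1} \<Longrightarrow> \<bar>u - x\<bar> < d3 \<Longrightarrow> \<bar>\<psi> u - \<psi> x\<bar> < e"
        using \<psi> x e(1) unfolding continuous_on_iff dist_real_def by metis
      show "\<exists>d>0. \<forall>a b. a \<le> x \<and> x \<le> b \<and> b - a < d \<longrightarrow> ?P a b"
      proof (intro exI[of _ "min d1 (min d2 d3)"] conjI allI impI)
        show "0 < min d1 (min d2 d3)" using d1 d2 d3 by simp
        fix a b assume ab: "a \<le> x \<and> x \<le> b \<and> b - a < min d1 (min d2 d3)" "0 \<le> a" "b \<le> 1" "a \<le> b"
        let ?l = "curve_length g a b"
        note rg = rectifiable_path_subinterval[OF g ab(2,4,3)]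
        have l: "0 \<le> ?l" using curve_length_nonneg[OF rg] ab by simp
        have lh: "curve_length h a b \<le> (K x + e) * ?l"
          using ab nn(2)[OF x] e by (intro curve_length_lipschitz_le(2)[OF _ rg] d1(2)) auto
        have "J a b \<le> (\<psi> x + e) * curve_length h a b"
          unfolding J_def
        proof (rule arclength_integral_bounds(2)[OF h \<psi> ab(2,4,3)])
          fix u assume u: "u \<in> {a..b}"
          then have "\<bar>u - x\<bar> < d3" using ab by auto
          with u show "\<psi> u \<le> \<psi> x + e" using d3(2)[of u] ab by auto
        qed
        also have "\<dots> \<le> (\<psi> x + e) * ((K x + e) * ?l)"
          using lh nn(1)[OF x] e by (intro mult_left_mono) auto
        finally have J: "J a b \<le> (\<psi> x + e) * (K x + e) * ?l" by (simp add: mult.assoc)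
        have "(\<phi> x - e) * ?l \<le> I a b"
          unfolding I_def
        proof (rule arclength_integral_bounds(1)[OF g \<phi> ab(2,4,3)])
          fix u assume u: "u \<in> {a..b}"
          then have "\<bar>u - x\<bar> < d2" using ab by auto
          with u show "\<phi> x - e \<le> \<phi> u" using d2(2)[of u] ab by auto
        qed
        then have I: "C * (\<phi> x - e) * ?l \<le> C * I a b" using nn(3) by (simp add: mult.assoc mult_left_mono)
        have "e * e \<le> e" using e by simp
        then have "(\<psi> x + e) * (K x + e) \<le> C * (\<phi> x - e) + e * S"
          using weight[OF x] unfolding S_def by (simp add: algebra_simps)
        also have "\<dots> \<le> C * (\<phi> x - e) + \<eta>" using e by simp
        finally have "(\<psi> x + e) * (K x + e) * ?l \<le> (C * (\<phi> x - e) + \<eta>) * ?l"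
          using l by (rule mult_right_mono)
        then show "J a b \<le> C * I a b + \<eta> * ?l" using J I by (simp add: algebra_simps)
      qed
    qed
    then show ?thesis by simp
  qed
  have L: "0 \<le> curve_length g 0 1"
    using curve_length_nonneg[OF rectifiable_path_subinterval[OF g]] by simp
  have "J 0 1 \<le> C * I 0 1"
  proof (rule field_le_epsilon)
    fix e :: real assume "e > 0"
    \<comment> \<open>The added 1 keeps the denominator positive for constant paths.\<close>
    then have "J 0 1 \<le> C * I 0 1 + e / (curve_length g 0 1 + 1) * curve_length g 0 1"
      using L by (intro main) simp
    also have "e / (curve_length g 0 1 + 1) * curve_length g 0 1 \<le> e"
      using L \<open>e > 0\<close> by (simp add: field_simps)
    finally show "J 0 1 \<le> C * I 0 1 + e" by simp
  qed
  then show ?thesis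
    unfolding I_def J_def arclength_integral_Icc_eq_Ioc[OF g \<phi>] arclength_integral_Icc_eq_Ioc[OF h \<psi>] .
qed

section \<open>The quasihyperbolic metric\<close>

lemma infdist_frontier_pos:
  assumes "proper_domain D" "z \<in> D"
  shows "0 < infdist z (frontier D)"
proof (rule infdist_pos_not_in_closed)
  show "frontier D \<noteq> {}" using assms(1) by (simp add: proper_domain_def frontier_not_empty)
  show "z \<notin> frontier D" using assms frontier_disjoint_eq unfolding proper_domain_def by blast
qed simp

text \<open>A connected set that meets \<open>D\<close> without lying in it meets the frontier, but
  no point of the open ball is that close to its centre.\<close>

lemma ball_infdist_frontier_subset:
  fixes D :: "complex set"
  assumes "z \<in> D"
  shows "ball z (infdist z (frontier D)) \<subseteq> D"
proof (rule ccontr)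
  assume not: "\<not> ball z (infdist z (frontier D)) \<subseteq> D"
  then have "0 < infdist z (frontier D)"
    by (metis ball_eq_empty empty_subsetI not_le)
  then have "z \<in> ball z (infdist z (frontier D)) \<inter> D" using assms by simp
  then have "ball z (infdist z (frontier D)) \<inter> frontier D \<noteq> {}"
    using not by (intro connected_Int_frontier[OF connected_ball]) blast+
  then show False using infdist_le[of _ "frontier D" z] by fastforce
qed

lemma infdist_frontier_le_dist:
  fixes D :: "complex set"
  assumes "z \<in> D" "p \<notin> D"
  shows "infdist z (frontier D) \<le> dist z p"
  using ball_infdist_frontier_subset[OF assms(1)] assms(2) by (force simp: not_le)

lemma infdist_frontier_ge:
  assumes "proper_domain D" "ball z r \<subseteq> D"
  shows "r \<le> infdist z (frontier D)"
proof -
  have "frontier D \<noteq> {}" using assms(1) by (simp add: proper_domain_def frontier_not_empty)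
  moreover have "r \<le> dist z w" if "w \<in> frontier D" for w
  proof -
    have "w \<notin> D" using that assms(1) frontier_disjoint_eq unfolding proper_domain_def by blast
    then show ?thesis using assms(2) by (force simp: not_less)
  qed
  ultimately show ?thesis by (simp add: infdist_notempty cINF_greatest)
qed

definition curves_in :: "complex set \<Rightarrow> complex \<Rightarrow> complex \<Rightarrow> (real \<Rightarrow> complex) set" where
  "curves_in D x y = {g. rectifiable_path g \<and> path_image g \<subseteq> D \<and> pathstart g = x \<and> pathfinish g = y}"

lemma curves_inD:
  assumes "g \<in> curves_in D x y"
  shows "rectifiable_path g" "continuous_on {0..1} g" "\<And>t. t \<in> {0..1} \<Longrightarrow> g t \<in> D" "g 0 = x" "g 1 = y"
  using assms unfolding curves_in_def rectifiable_path_def path_def pathstart_def pathfinish_def path_image_def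
  by auto

lemma continuous_on_weight:
  assumes "proper_domain D" "g \<in> curves_in D x y"
  shows "continuous_on {0..1} (\<lambda>t. 1 / infdist (g t) (frontier D))"
  using infdist_frontier_pos[OF assms(1)] curves_inD[OF assms(2)]
  by (intro continuous_intros) force+

lemma lipschitz_rectifiable_path:
  fixes g :: "real \<Rightarrow> 'a::metric_space"
  assumes "\<And>u v. u \<in> {0..1} \<Longrightarrow> v \<in> {0..1} \<Longrightarrow> dist (g u) (g v) \<le> B * dist u v" and B: "B \<ge> 0"
  shows "rectifiable_path g" "0 \<le> s \<Longrightarrow> s \<le> t \<Longrightarrow> t \<le> 1 \<Longrightarrow> curve_length g s t \<le> B * (t - s)"
proof -
  have "B-lipschitz_on {0..1} g" using assms by (intro lipschitz_onI) auto
  then have "path g" unfolding path_def by (rule lipschitz_on_continuous_on)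
  moreover have "rectifiable_on g 0 1"
    by (rule curve_length_lipschitz_le(1)[where g = "\<lambda>x::real. x" and K = B])
       (use assms curve_length_id(1)[of 0 1] in auto)
  ultimately show "rectifiable_path g" by (simp add: rectifiable_path_def)
  show "curve_length g s t \<le> B * (t - s)" if st: "0 \<le> s" "s \<le> t" "t \<le> 1"
  proof -
    have "curve_length g s t \<le> B * curve_length (\<lambda>x::real. x) s t"
      by (rule curve_length_lipschitz_le(2)) (use st assms curve_length_id(1)[OF st(2)] in auto)
    then show ?thesis by (simp add: curve_length_id(2)[OF st(2)])
  qed
qed

text \<open>A lower bound for all members bounds a real infimum only over a nonempty set. Points of
  an open connected set can be joined by polynomial curves, which are Lipschitz on the unit
  interval.\<close>

lemma curves_in_nonempty:
  assumes "proper_domain D" "x \<in> D" "y \<in> D"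
  shows "curves_in D x y \<noteq> {}"
proof -
  obtain g where g: "polynomial_function g" "path_image g \<subseteq> D" "pathstart g = x" "pathfinish g = y"
    using connected_open_polynomial_connected[of D x y] assms unfolding proper_domain_def by blast
  obtain g' where g': "polynomial_function g'" "\<And>t. (g has_vector_derivative g' t) (at t)"
    using has_vector_derivative_polynomial_function[OF g(1)] by blast
  have "bounded (g' ` {0..1})"
    using continuous_on_polymonial_function[OF g'(1)] by (intro compact_imp_bounded compact_continuous_image) auto
  then obtain B where "B > 0" and B: "\<forall>w\<in>g' ` {0..1}. norm w \<le> B" unfolding bounded_pos by blast
  have "dist (g u) (g v) \<le> B * dist u v" if "u \<in> {0..1}" "v \<in> {0..1}" for u v
    unfolding dist_norm
  proof (rule differentiable_bound[where S = "{0..1}" and f' = "\<lambda>t h. h *\<^sub>R g' t"])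
    show "(g has_derivative (\<lambda>h. h *\<^sub>R g' t)) (at t within {0..1})" for t
      using g'(2)[of t] unfolding has_vector_derivative_def by (rule has_derivative_at_withinI)
    fix t :: real assume "t \<in> {0..1}"
    then have "norm (g' t) \<le> B" using B by blast
    then show "onorm (\<lambda>h. h *\<^sub>R g' t) \<le> B"
    proof (intro onorm_le)
      show "norm (h *\<^sub>R g' t) \<le> B * norm h" if "norm (g' t) \<le> B" for h
        using mult_left_mono[OF that, of "norm h"] by (simp add: mult.commute)
    qed
  qed (use that in auto)
  then have "rectifiable_path g" using \<open>B > 0\<close> by (intro lipschitz_rectifiable_path(1)[of g B]) auto
  then show ?thesis using g unfolding curves_in_def by blast
qed

lemma arclength_integral_weight_nonneg:
  "0 \<le> arclength_integral g (\<lambda>z. 1 / infdist z A)"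
  unfolding arclength_integral_def set_lebesgue_integral_def
  by (intro Bochner_Integration.integral_nonneg) (simp add: infdist_nonneg)

lemma quasihyperbolic_le:
  assumes "g \<in> curves_in D x y"
  shows "quasihyperbolic D x y \<le> arclength_integral g (\<lambda>z. 1 / infdist z (frontier D))"
  unfolding quasihyperbolic_def curves_in_def[symmetric]
  using arclength_integral_weight_nonneg assms
  by (intro cINF_lower bdd_belowI2[of _ 0]) auto

lemma quasihyperbolic_ge:
  assumes "proper_domain D" "x \<in> D" "y \<in> D"
    and "\<And>g. g \<in> curves_in D x y \<Longrightarrow> c \<le> arclength_integral g (\<lambda>z. 1 / infdist z (frontier D))"
  shows "c \<le> quasihyperbolic D x y"
  unfolding quasihyperbolic_def curves_in_def[symmetric]
  using assms by (intro cINF_greatest curves_in_nonempty)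

lemma quasihyperbolic_nonneg:
  assumes "proper_domain D" "x \<in> D" "y \<in> D"
  shows "0 \<le> quasihyperbolic D x y"
  using assms by (intro quasihyperbolic_ge arclength_integral_weight_nonneg)

text \<open>Only the initial arc of a curve up to its first exit from \<open>ball x (dist x y)\<close> is counted.\<close>

lemma quasihyperbolic_ge_omitted:
  assumes D: "proper_domain D" and xy: "x \<in> D" "y \<in> D" and p: "p \<notin> D"
  shows "dist x y / (dist x p + dist x y) \<le> quasihyperbolic D x y"
proof (rule quasihyperbolic_ge[OF D xy])
  fix g assume "g \<in> curves_in D x y"
  note g = curves_inD[OF this] and weight = continuous_on_weight[OF D this]
  define r where "r = dist x y"
  define W where "W = (\<lambda>t. 1 / infdist (g t) (frontier D))"
  have cont: "continuous_on {0..1} (\<lambda>t. dist x (g t))" by (intro continuous_intros g)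
  \<comment> \<open>The endpoint \<open>y\<close> lies on the circle of radius \<open>r\<close>
    around \<open>x\<close>, so the curve meets this circle; \<open>T\<close> will be the first
    time. Up to then the distance to the omitted point \<open>p\<close> is at most
    \<open>dist x p + r\<close>.\<close>
  define E where "E = {t \<in> {0..1}. dist x (g t) = r}"
  have "closed E"
    unfolding E_def using continuous_closed_preimage_constant[OF cont closed_atLeastAtMost] by simp
  moreover have "E \<subseteq> {0..1}" by (auto simp: E_def)
  ultimately have "compact E" by (meson bounded_closed_interval bounded_subset compact_eq_bounded_closed)
  moreover have "1 \<in> E" using g by (simp add: E_def r_def)
  ultimately obtain T where T: "T \<in> E" "\<And>t. t \<in> E \<Longrightarrow> T \<le> t"
    using compact_attains_inf[of E] by auto
  have T01: "0 \<le> T" "T \<le> 1" using T(1) by (auto simp: E_def)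
  have near: "dist x (g t) \<le> r" if t: "t \<in> {0..T}" for t
  proof (rule ccontr)
    assume far: "\<not> dist x (g t) \<le> r"
    have "\<exists>s\<ge>0. s \<le> t \<and> dist x (g s) = r"
    proof (rule IVT')
      show "continuous_on {0..t} (\<lambda>s. dist x (g s))"
        using t T01 by (intro continuous_on_subset[OF cont]) auto
      show "dist x (g 0) \<le> r" using g(4) by (simp add: r_def)
    qed (use t far in auto)
    then obtain s where s: "0 \<le> s" "s \<le> t" "dist x (g s) = r" by blast
    then have "T \<le> s" using t T01 by (intro T(2)) (auto simp: E_def)
    then have "s = t" using s t by auto
    then show False using s(3) far by simp
  qed
  have lower: "1 / (dist x p + r) \<le> W t" if t: "t \<in> {0..T}" for t
  proof -
    have gt: "g t \<in> D" using t T01 by (intro g(3)) auto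
    have "infdist (g t) (frontier D) \<le> dist (g t) p" by (rule infdist_frontier_le_dist[OF gt p])
    also have "\<dots> \<le> dist x p + r" using near[OF t] dist_triangle[of "g t" p x] by (simp add: dist_commute)
    finally show ?thesis unfolding W_def using infdist_frontier_pos[OF D gt] by (intro divide_left_mono mult_pos_pos) auto
  qed
  have px: "0 \<le> 1 / (dist x p + r)" by (simp add: r_def)
  have "r = dist (g 0) (g T)" using T(1) g by (simp add: E_def)
  also have "\<dots> \<le> curve_length g 0 T"
    using T01 by (intro dist_le_curve_length rectifiable_path_subinterval[OF g(1)]) auto
  finally have "1 / (dist x p + r) * r \<le> 1 / (dist x p + r) * curve_length g 0 T"
    using px by (rule mult_left_mono)
  also have "\<dots> \<le> (LINT t:{0<..T}|arclength_measure g. W t)"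
    using weight T01 unfolding W_def[symmetric] by (intro arclength_integral_bounds(1)[OF g(1) _ _ _ _ lower]) auto
  also have "\<dots> \<le> (LINT t:{0<..T}|arclength_measure g. W t) + (LINT t:{T<..1}|arclength_measure g. W t)"
    unfolding set_lebesgue_integral_def
    by (simp add: W_def infdist_nonneg Bochner_Integration.integral_nonneg)
  also have "\<dots> = (LINT t:{0<..1}|arclength_measure g. W t)"
    using weight T01 unfolding W_def[symmetric] by (intro arclength_integral_Ioc_add[OF g(1), symmetric]) auto
  also have "\<dots> = arclength_integral g (\<lambda>z. 1 / infdist z (frontier D))"
    using arclength_integral_Icc_eq_Ioc[OF g(1) weight] by (simp add: arclength_integral_def W_def)
  finally show "dist x y / (dist x p + dist x y) \<le> arclength_integral g (\<lambda>z. 1 / infdist z (frontier D))"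
    by (simp add: r_def)
qed

section \<open>Conformal maps and the quasihyperbolic metric\<close>

lemma conformal_inverse:
  assumes D: "proper_domain D" and f: "conformal_map_on f D"
  obtains h where "conformal_map_on h (f ` D)" "\<And>z. z \<in> D \<Longrightarrow> h (f z) = z" "h ` f ` D = D"
proof -
  have fD: "f holomorphic_on D" "inj_on f D" "open D"
    using D f by (auto simp: proper_domain_def conformal_map_on_def)
  obtain h where h: "h holomorphic_on f ` D" "\<And>z. z \<in> D \<Longrightarrow> h (f z) = z"
    using holomorphic_has_inverse[OF fD(1,3,2)] by metis
  have "inj_on h (f ` D)" using h(2) by (auto simp: inj_on_def)
  moreover have "h ` f ` D = D" using h(2) by (force simp: image_iff)
  ultimately show thesis using h that by (auto simp: conformal_map_on_def)
qed

text \<open>If the image were the plane, the inverse map would be an injective entire function with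
  range \<open>D\<close>, and hence surjective.\<close>

lemma proper_domain_conformal_image:
  assumes D: "proper_domain D" and f: "conformal_map_on f D"
  shows "proper_domain (f ` D)"
proof -
  have fD: "f holomorphic_on D" "inj_on f D" "open D" "connected D" "D \<noteq> {}" "D \<noteq> UNIV"
    using D f by (auto simp: proper_domain_def conformal_map_on_def)
  have "f ` D \<noteq> UNIV"
  proof
    assume "f ` D = UNIV"
    then obtain h where "conformal_map_on h UNIV" "range h = D"
      using conformal_inverse[OF D f] by metis
    then show False using injective_entire_surj[of h] fD by (simp add: conformal_map_on_def)
  qed
  then show ?thesis
    using fD open_mapping_thm3[OF fD(1,3,2)]
      connected_continuous_image[OF holomorphic_on_imp_continuous_on[OF fD(1)]]
    by (simp add: proper_domain_def)
qed

text \<open>The Koebe one-quarter theorem on the largest disc around \<open>z\<close> in \<open>D\<close>.\<close>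

lemma quasihyperbolic_density_le:
  assumes D: "proper_domain D" and f: "conformal_map_on f D" and z: "z \<in> D"
  shows "1 / infdist (f z) (frontier (f ` D)) * cmod (deriv f z) \<le> 4 * (1 / infdist z (frontier D))"
proof -
  define R where "R = infdist z (frontier D)"
  have R: "R > 0" unfolding R_def by (rule infdist_frontier_pos[OF D z])
  have sub: "ball z R \<subseteq> D" unfolding R_def by (rule ball_infdist_frontier_subset[OF z])
  have "f holomorphic_on ball z R" "inj_on f (ball z R)"
    using f sub by (auto simp: conformal_map_on_def intro: holomorphic_on_subset inj_on_subset)
  then have "ball (f z) (cmod (deriv f z) * R / 4) \<subseteq> f ` ball z R"
    using R by (rule koebe_quarter)
  then have "cmod (deriv f z) * R / 4 \<le> infdist (f z) (frontier (f ` D))"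
    using sub by (intro infdist_frontier_ge proper_domain_conformal_image[OF D f]) auto
  moreover have "0 < infdist (f z) (frontier (f ` D))"
    using z by (intro infdist_frontier_pos proper_domain_conformal_image[OF D f]) auto
  ultimately show ?thesis using R unfolding R_def[symmetric] by (simp add: field_simps)
qed

text \<open>The mean value inequality on a ball, which is convex, so small that the derivative
  varies by less than \<open>e\<close>. It supplies the premise \<open>loc\<close> of
  \<open>arclength_integral_comparison\<close> with |f'| as local factor.\<close>

lemma holomorphic_locally_lipschitz:
  assumes f: "f holomorphic_on D" and D: "open D" and z: "z \<in> D" and e: "e > 0"
  obtains r where "r > 0"
    "\<And>u v. u \<in> ball z r \<Longrightarrow> v \<in> ball z r \<Longrightarrow> dist (f u) (f v) \<le> (cmod (deriv f z) + e) * dist u v"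
proof -
  obtain r1 where r1: "r1 > 0" "ball z r1 \<subseteq> D" using D z openE by blast
  have "isCont (deriv f) z"
    using holomorphic_on_imp_continuous_on[OF holomorphic_deriv[OF f D]] D z
    by (simp add: continuous_on_eq_continuous_at)
  then obtain r2 where r2: "r2 > 0" "\<And>w. dist w z < r2 \<Longrightarrow> dist (deriv f w) (deriv f z) < e"
    using e unfolding continuous_at_eps_delta by blast
  let ?r = "min r1 r2"
  have B: "cmod (deriv f w) \<le> cmod (deriv f z) + e" if "w \<in> ball z ?r" for w
  proof -
    have "dist (deriv f w) (deriv f z) < e" using that by (intro r2) (simp add: dist_commute)
    then show ?thesis using norm_triangle_ineq2[of "deriv f w" "deriv f z"] by (simp add: dist_norm)
  qed
  have "dist (f u) (f v) \<le> (cmod (deriv f z) + e) * dist u v" if "u \<in> ball z ?r" "v \<in> ball z ?r" for u v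
    unfolding dist_norm
  proof (rule field_differentiable_bound[where S = "ball z ?r" and f' = "deriv f"])
    fix w assume w: "w \<in> ball z ?r"
    then have "w \<in> D" using r1 by auto
    then show "(f has_field_derivative deriv f w) (at w within ball z ?r)"
      by (rule has_field_derivative_at_within[OF holomorphic_derivI[OF f D]])
    show "cmod (deriv f w) \<le> cmod (deriv f z) + e" by (rule B[OF w])
  qed (use that in auto)
  then show thesis using that[of ?r] r1 r2 by simp
qed

lemma quasihyperbolic_conformal_le:
  assumes D: "proper_domain D" and f: "conformal_map_on f D" and xy: "x \<in> D" "y \<in> D"
  shows "quasihyperbolic (f ` D) (f x) (f y) \<le> 4 * quasihyperbolic D x y"
proof -
  have fD: "f holomorphic_on D" "open D" using D f by (auto simp: proper_domain_def conformal_map_on_def)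
  note D' = proper_domain_conformal_image[OF D f]
  have "quasihyperbolic (f ` D) (f x) (f y) / 4 \<le> quasihyperbolic D x y"
  proof (rule quasihyperbolic_ge[OF D xy])
    fix g assume gc: "g \<in> curves_in D x y"
    note g = curves_inD[OF gc]
    have loc: "\<exists>d>0. \<forall>u\<in>{0..1}. \<forall>v\<in>{0..1}. \<bar>u - t\<bar> < d \<longrightarrow> \<bar>v - t\<bar> < d \<longrightarrow>
        dist ((f \<circ> g) u) ((f \<circ> g) v) \<le> (cmod (deriv f (g t)) + e) * dist (g u) (g v)"
      if t: "t \<in> {0..1}" and "e > 0" for t e
    proof -
      obtain r where r: "r > 0" "\<And>u v. u \<in> ball (g t) r \<Longrightarrow> v \<in> ball (g t) r \<Longrightarrow>
          dist (f u) (f v) \<le> (cmod (deriv f (g t)) + e) * dist u v"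
        using holomorphic_locally_lipschitz[OF fD g(3)[OF t] \<open>e > 0\<close>] by blast
      obtain d where "d > 0" "\<forall>u\<in>{0..1}. dist u t < d \<longrightarrow> dist (g u) (g t) < r"
        using g(2) t r(1) unfolding continuous_on_iff by blast
      then show ?thesis
        by (intro exI[of _ d]) (auto simp: dist_real_def dist_commute intro!: r(2))
    qed
    have "path (f \<circ> g)"
      using g(2,3) holomorphic_on_imp_continuous_on[OF fD(1)] unfolding path_def
      by (intro continuous_on_compose) (auto intro: continuous_on_subset)
    then have rect: "rectifiable_path (f \<circ> g)"
    proof (rule rectifiable_path_lipschitz_local[OF g(1)])
      fix t :: real assume "t \<in> {0..1}"
      from loc[OF this zero_less_one] show "\<exists>L\<ge>0. \<exists>d>0. \<forall>u\<in>{0..1}. \<forall>v\<in>{0..1}. \<bar>u - t\<bar> < d \<longrightarrow> \<bar>v - t\<bar> < d \<longrightarrow>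
          dist ((f \<circ> g) u) ((f \<circ> g) v) \<le> L * dist (g u) (g v)"
        by (intro exI[of _ "cmod (deriv f (g t)) + 1"]) auto
    qed
    have fgc: "f \<circ> g \<in> curves_in (f ` D) (f x) (f y)"
      using gc rect unfolding curves_in_def
      by (auto simp: path_image_compose pathstart_compose pathfinish_compose)
    have "arclength_integral (f \<circ> g) (\<lambda>z. 1 / infdist z (frontier (f ` D)))
       \<le> 4 * arclength_integral g (\<lambda>z. 1 / infdist z (frontier D))"
      unfolding arclength_integral_def
    proof (rule arclength_integral_comparison[OF g(1) rect continuous_on_weight[OF D gc] continuous_on_weight[OF D' fgc] _ _ _ loc])
      show "1 / infdist ((f \<circ> g) t) (frontier (f ` D)) * cmod (deriv f (g t)) \<le> 4 * (1 / infdist (g t) (frontier D))"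
        if "t \<in> {0..1}" for t
        using quasihyperbolic_density_le[OF D f g(3)[OF that]] by simp
    qed (auto simp: infdist_nonneg)
    then show "quasihyperbolic (f ` D) (f x) (f y) / 4 \<le> arclength_integral g (\<lambda>z. 1 / infdist z (frontier D))"
      using quasihyperbolic_le[OF fgc] by linarith
  qed
  then show ?thesis by simp
qed

lemma quasihyperbolic_conformal_ge:
  assumes D: "proper_domain D" and f: "conformal_map_on f D" and xy: "x \<in> D" "y \<in> D"
  shows "quasihyperbolic D x y \<le> 4 * quasihyperbolic (f ` D) (f x) (f y)"
proof -
  obtain h where h: "conformal_map_on h (f ` D)" "\<And>z. z \<in> D \<Longrightarrow> h (f z) = z" "h ` f ` D = D"
    using conformal_inverse[OF D f] by blast
  show ?thesis
    using quasihyperbolic_conformal_le[OF proper_domain_conformal_image[OF D f] h(1), of "f x" "f y"] h(2,3) xy by simp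
qed

section \<open>Sharpness\<close>

definition koebe :: "complex \<Rightarrow> complex" where
  "koebe z = z / (1 - z)\<^sup>2"

lemma proper_domain_unit_disc: "proper_domain (ball 0 1)"
  by (auto simp: proper_domain_def ball_eq_empty dest: arg_cong[where f = bounded])

lemma conformal_koebe: "conformal_map_on koebe (ball 0 1)"
  unfolding conformal_map_on_def
proof
  show "koebe holomorphic_on ball 0 1"
    unfolding koebe_def by (intro holomorphic_intros) auto
  show "inj_on koebe (ball 0 1)"
  proof (rule inj_onI)
    fix z w :: complex assume zw: "z \<in> ball 0 1" "w \<in> ball 0 1" "koebe z = koebe w"
    then have "1 - z \<noteq> 0" "1 - w \<noteq> 0" by auto
    then have "z * (1 - w)\<^sup>2 = w * (1 - z)\<^sup>2" using zw(3) by (simp add: koebe_def frac_eq_eq)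
    then have "(z - w) * (1 - z * w) = 0" by (simp add: power2_eq_square algebra_simps)
    moreover have "z * w \<noteq> 1"
    proof
      assume "z * w = 1"
      then have "cmod z * cmod w = 1" by (metis norm_mult norm_one)
      moreover have "cmod z * cmod w < 1" using zw(1,2) mult_strict_mono'[of "cmod z" 1 "cmod w" 1] by simp
      ultimately show False by simp
    qed
    ultimately show "z = w" by auto
  qed
qed

text \<open>The value -1/4 would force (1 + z)^2 = 0 and is thus taken only at the boundary point
  -1. It is the tip of the slit that the Koebe function omits.\<close>

lemma koebe_omits: "- 1 / 4 \<notin> koebe ` ball 0 1"
proof
  assume "- 1 / 4 \<in> koebe ` ball 0 1"
  then obtain z where z: "z \<in> ball 0 1" "- 1 / 4 = koebe z" by blast
  then have "1 - z \<noteq> 0" by auto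
  with z(2) have "- ((1 - z)\<^sup>2) = z * 4" by (simp add: koebe_def field_simps)
  moreover have "(1 + z)\<^sup>2 = z * 4 + (1 - z)\<^sup>2" by (simp add: power2_eq_square algebra_simps)
  ultimately have "(1 + z)\<^sup>2 = 0" by (metis add.left_inverse)
  then have "z = - 1" by (simp add: add_eq_0_iff)
  then show False using z(1) by simp
qed

text \<open>The density along the radial segment is at most 1 / (1 - x). Integrating it exactly
  would give - ln (1 - x); the bound here agrees with this to first order at 0, which decides the
  limit.\<close>

lemma quasihyperbolic_unit_disc_le:
  assumes x: "0 < x" "x < 1"
  shows "quasihyperbolic (ball 0 1) 0 (of_real x) \<le> x / (1 - x)"
proof -
  define g where "g = linepath 0 (complex_of_real x)"
  have g: "g t = of_real (t * x)" for t by (simp add: g_def linepath_def scaleR_conv_of_real)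
  have lip: "dist (g u) (g v) \<le> x * dist u v" for u v
    using x unfolding g dist_of_real dist_real_def left_diff_distrib[symmetric] by (simp add: abs_mult)
  have rect: "rectifiable_path g" and len: "curve_length g 0 1 \<le> x"
    using lipschitz_rectifiable_path[of g x] lipschitz_rectifiable_path(2)[of g x 0 1] lip x by auto
  have n: "cmod (g t) \<le> x" if "t \<in> {0..1}" for t
    using that x by (simp add: g norm_mult mult_left_le_one_le)
  have "path_image g \<subseteq> ball 0 1"
    using n x unfolding path_image_def by fastforce
  then have gc: "g \<in> curves_in (ball 0 1) 0 (of_real x)"
    using rect by (simp add: curves_in_def g_def)
  have up: "1 / infdist (g t) (frontier (ball 0 1)) \<le> 1 / (1 - x)" if "t \<in> {0..1}" for t
  proof -
    have "ball (g t) (1 - x) \<subseteq> ball 0 1"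
    proof
      fix w assume "w \<in> ball (g t) (1 - x)"
      then show "w \<in> ball 0 1" using n[OF that] norm_triangle_sub[of w "g t"] by (simp add: dist_norm norm_minus_commute)
    qed
    then have "1 - x \<le> infdist (g t) (frontier (ball 0 1))"
      by (rule infdist_frontier_ge[OF proper_domain_unit_disc])
    then show ?thesis using x by (intro divide_left_mono mult_pos_pos) auto
  qed
  note weight = continuous_on_weight[OF proper_domain_unit_disc gc]
  have "quasihyperbolic (ball 0 1) 0 (of_real x) \<le> arclength_integral g (\<lambda>z. 1 / infdist z (frontier (ball 0 1)))"
    by (rule quasihyperbolic_le[OF gc])
  also have "\<dots> = (LINT t:{0<..1}|arclength_measure g. 1 / infdist (g t) (frontier (ball 0 1)))"
    unfolding arclength_integral_def by (rule arclength_integral_Icc_eq_Ioc[OF rect weight])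
  also have "\<dots> \<le> 1 / (1 - x) * curve_length g 0 1"
    using up by (intro arclength_integral_bounds(2)[OF rect weight]) auto
  also have "\<dots> \<le> 1 / (1 - x) * x" using len x by (intro mult_left_mono) auto
  finally show ?thesis by simp
qed

text \<open>The omitted point -1/4 has distance 1/4 from \<open>koebe 0 = 0\<close>, so the bound
  behaves like 4 * x for small \<open>x\<close>.\<close>

lemma quasihyperbolic_koebe_ge:
  assumes x: "0 < x" "x < 1"
  defines "r \<equiv> x / (1 - x)\<^sup>2"
  shows "r / (1 / 4 + r) \<le> quasihyperbolic (koebe ` ball 0 1) (koebe 0) (koebe (of_real x))"
proof -
  have r: "r > 0" using x by (simp add: r_def)
  have k: "koebe 0 = 0" "koebe (of_real x) = of_real r" by (simp_all add: koebe_def r_def)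
  have "koebe 0 \<in> koebe ` ball 0 1" "koebe (of_real x) \<in> koebe ` ball 0 1" using x by auto
  from quasihyperbolic_ge_omitted[OF proper_domain_conformal_image[OF proper_domain_unit_disc conformal_koebe] this koebe_omits]
  show ?thesis using r by (simp add: k norm_divide)
qed

text \<open>This product is the upper bound x / (1 - x) for the disc divided by the lower bound for
  its image.\<close>

lemma tendsto_koebe_ratio:
  "((\<lambda>x::real. (1 - x) * (1 / 4 + x / (1 - x)\<^sup>2)) \<longlongrightarrow> 1 / 4) (at_right 0)"
proof -
  have "((\<lambda>x::real. (1 - x) * (1 / 4 + x / (1 - x)\<^sup>2)) \<longlongrightarrow> (1 - 0) * (1 / 4 + 0 / (1 - 0)\<^sup>2)) (at_right 0)"
    by (intro tendsto_intros) auto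
  then show ?thesis by simp
qed

lemma eventually_at_right_0_unit: "\<forall>\<^sub>F x::real in at_right 0. 0 < x \<and> x < 1"
  unfolding eventually_at_right_field by (intro exI[of _ 1]) auto

theorem proposition1p6:
  shows
    "(\<forall>D f x y. proper_domain D \<and> conformal_map_on f D \<and> x \<in> D \<and> y \<in> D \<longrightarrow>
        (1/4) * quasihyperbolic D x y \<le> quasihyperbolic (f ` D) (f x) (f y) \<and>
        quasihyperbolic (f ` D) (f x) (f y) \<le> 4 * quasihyperbolic D x y)
     \<and> (\<forall>c::real.
          (\<forall>D f x y. proper_domain D \<and> conformal_map_on f D \<and> x \<in> D \<and> y \<in> D \<longrightarrow>
             quasihyperbolic (f ` D) (f x) (f y) \<le> c * quasihyperbolic D x y)
          \<longrightarrow> 4 \<le> c)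
     \<and> (\<forall>c::real.
          (\<forall>D f x y. proper_domain D \<and> conformal_map_on f D \<and> x \<in> D \<and> y \<in> D \<longrightarrow>
             c * quasihyperbolic D x y \<le> quasihyperbolic (f ` D) (f x) (f y))
          \<longrightarrow> c \<le> 1/4)"
proof (intro conjI allI impI)
  fix D f x y assume *: "proper_domain D \<and> conformal_map_on f D \<and> x \<in> D \<and> y \<in> D"
  then show "(1/4) * quasihyperbolic D x y \<le> quasihyperbolic (f ` D) (f x) (f y)"
    using quasihyperbolic_conformal_ge[of D f x y] by simp
  from * show "quasihyperbolic (f ` D) (f x) (f y) \<le> 4 * quasihyperbolic D x y"
    using quasihyperbolic_conformal_le[of D f x y] by simp
next
  fix c :: real
  assume c: "\<forall>D f x y. proper_domain D \<and> conformal_map_on f D \<and> x \<in> D \<and> y \<in> D \<longrightarrow>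
             quasihyperbolic (f ` D) (f x) (f y) \<le> c * quasihyperbolic D x y"
  have "1 \<le> c * ((1 - x) * (1 / 4 + x / (1 - x)\<^sup>2))" if x: "0 < x" "x < 1" for x
  proof -
    define s q where "s = 1 - x" and "q = 1 / 4 + x / s\<^sup>2"
    have s: "s > 0" "q > 0" using x by (auto simp: s_def q_def add_pos_nonneg)
    have "x / s\<^sup>2 / q \<le> quasihyperbolic (koebe ` ball 0 1) (koebe 0) (koebe (of_real x))"
      using quasihyperbolic_koebe_ge[OF x] by (simp add: s_def q_def)
    also have "\<dots> \<le> c * quasihyperbolic (ball 0 1) 0 (of_real x)"
      using c proper_domain_unit_disc conformal_koebe x by auto
    finally have 1: "x / s\<^sup>2 / q \<le> c * quasihyperbolic (ball 0 1) 0 (of_real x)" .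
    \<comment> \<open>\<open>c\<close> is an arbitrary real here; its sign is needed before the
      upper bound for the disc can be multiplied by it.\<close>
    have "0 < x / s\<^sup>2 / q" using s x by simp
    with 1 have "0 < c * quasihyperbolic (ball 0 1) 0 (of_real x)" by linarith
    moreover have "0 \<le> quasihyperbolic (ball 0 1) 0 (of_real x)"
      using x by (intro quasihyperbolic_nonneg[OF proper_domain_unit_disc]) auto
    ultimately have "c \<ge> 0" by (auto simp: zero_less_mult_iff)
    then have "c * quasihyperbolic (ball 0 1) 0 (of_real x) \<le> c * (x / s)"
      unfolding s_def by (intro mult_left_mono quasihyperbolic_unit_disc_le x)
    with 1 have "x / s\<^sup>2 / q \<le> c * (x / s)" by linarith
    then have "1 \<le> c * (s * q)" using s x by (simp add: field_simps power2_eq_square)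
    then show ?thesis by (simp add: s_def q_def)
  qed
  then have ev: "\<forall>\<^sub>F x in at_right 0. 1 \<le> c * ((1 - x) * (1 / 4 + x / (1 - x)\<^sup>2))"
    using eventually_at_right_0_unit by (auto elim: eventually_mono)
  have "1 \<le> c * (1 / 4)"
    by (rule tendsto_lowerbound[OF tendsto_mult_left[OF tendsto_koebe_ratio] ev]) simp
  then show "4 \<le> c" by simp
next
  fix c :: real
  assume c: "\<forall>D f x y. proper_domain D \<and> conformal_map_on f D \<and> x \<in> D \<and> y \<in> D \<longrightarrow>
             c * quasihyperbolic D x y \<le> quasihyperbolic (f ` D) (f x) (f y)"
  \<comment> \<open>The extremal map for the lower constant is the inverse of the Koebe function,
    which shrinks the metric by a factor tending to 1/4 near 0.\<close>
  obtain h where h: "conformal_map_on h (koebe ` ball 0 1)" "\<And>z. z \<in> ball 0 1 \<Longrightarrow> h (koebe z) = z"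
    "h ` koebe ` ball 0 1 = ball 0 1"
    using conformal_inverse[OF proper_domain_unit_disc conformal_koebe] by blast
  note K = proper_domain_conformal_image[OF proper_domain_unit_disc conformal_koebe]
  show "c \<le> 1/4"
  \<comment> \<open>For positive \<open>c\<close> the lower bound for the Koebe domain may be
    multiplied by \<open>c\<close>; otherwise the claim is immediate.\<close>
  proof (cases "c \<le> 0")
    case False
    have "c \<le> (1 - x) * (1 / 4 + x / (1 - x)\<^sup>2)" if x: "0 < x" "x < 1" for x
    proof -
      define s q where "s = 1 - x" and "q = 1 / 4 + x / s\<^sup>2"
      have s: "s > 0" "q > 0" using x by (auto simp: s_def q_def add_pos_nonneg)
      have "c * (x / s\<^sup>2 / q) \<le> c * quasihyperbolic (koebe ` ball 0 1) (koebe 0) (koebe (of_real x))"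
        using quasihyperbolic_koebe_ge[OF x] False by (intro mult_left_mono) (auto simp: s_def q_def)
      also have "\<dots> \<le> quasihyperbolic (h ` koebe ` ball 0 1) (h (koebe 0)) (h (koebe (of_real x)))"
        using c K h(1) x by auto
      also have "\<dots> \<le> x / s"
        unfolding h(3) s_def using x quasihyperbolic_unit_disc_le[OF x] by (simp add: h(2))
      finally have "c \<le> s * q" using s x by (simp add: field_simps power2_eq_square)
      then show ?thesis by (simp add: s_def q_def)
    qed
    then have ev: "\<forall>\<^sub>F x in at_right 0. c \<le> (1 - x) * (1 / 4 + x / (1 - x)\<^sup>2)"
      using eventually_at_right_0_unit by (auto elim: eventually_mono)
    show ?thesis by (rule tendsto_lowerbound[OF tendsto_koebe_ratio ev]) simp
  qed simp
qed

end
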